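(* Let $n\ge1$ and let $\Omega\subset\mathbb{R}^{n+1}$ be a bounded domain. Then for every $f\in L^2(\Omega,\mathcal{A})$ there exists $u\in L^2(\Omega,\mathcal{A})$ such that $\overline{D}u=f$ in the weak sense on $\Omega$.
   Context: Clifford algebra: $\mathcal{A}$ is the real $2^n$-dimensional unital associative algebra generated by $e_1,\dots,e_n$ with $e_0=1$ the unit, $e_ie_j+e_je_i=0$ for $1\le i\neq j\le n$ and $e_i^2=-1$ for $1\le i\le n$; its basis is $e_A=e_{h_1}\cdots e_{h_r}$ for $A=\{h_1<\dots<h_r\}\subset\{1,\dots,n\}$, with $e_\emptyset=e_0$. Operators: points of $\mathbb{R}^{n+1}$ are $x=(x_0,\dots,x_n)$; for $g=\sum_A g_Ae_A$, $\overline{D}g=\sum_{i=0}^n\sum_A e_ie_A\partial_{x_i}g_A$ and $g\overline{D}=\sum_{i=0}^n\sum_A e_Ae_i\partial_{x_i}g_A$. Spaces: $L^2(\Omega,\mathcal{A})$ is the set of $f=\sum_A f_Ae_A:\Omega\to\mathcal{A}$ with $\int_\Omega|f_A|^2dx<\infty$ for all $A$ (Lebesgue measure). $C_0^\infty(\Omega,\mathcal{A})$ is the set of $\mathcal{A}$-valued functions all of whose components are real-valued, smooth and compactly supported in $\Omega$. Weak solution: $\overline{D}u=f$ in the weak sense on $\Omega$ means $\int_\Omega\alpha f\,dx=-\int_\Omega(\alpha\overline{D})u\,dx$ for every $\alpha\in C_0^\infty(\Omega,\mathcal{A})$. *)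

theory Defs
  imports "HOL-Analysis.Analysis"
begin

section \<open>The Clifford algebra on \<open>n = CARD('n)\<close> generators\<close>

text \<open>
  The generators are indexed by a finite linearly ordered type \<open>'n\<close>. An element
  \<open>g = (\<Sum>A. g\<^sub>A e\<^sub>A)\<close> is represented by its coordinate vector, so \<open>g $ A\<close> is \<open>g\<^sub>A\<close>. The product is
  given by its structure constants: moving the generators of \<open>B\<close> past the larger ones of \<open>A\<close> and
  contracting equal pairs by \<open>e\<^sub>i\<^sup>2 = -1\<close> costs one sign for every \<open>(a, b) \<in> A \<times> B\<close> with
  \<open>b \<le> a\<close>. The lemmas below show that this is the unital associative algebra with the required
  generators, relations and basis.
\<close>

type_synonym 'n clifford = "real ^ ('n set)"

definition cl_sign :: "'n::{finite,linorder} set \<Rightarrow> 'n set \<Rightarrow> real" where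
  "cl_sign A B = (-1) ^ card {(a, b). a \<in> A \<and> b \<in> B \<and> b \<le> a}"

definition cl_basis :: "'n::{finite,linorder} set \<Rightarrow> 'n clifford" where
  "cl_basis A = axis A 1"

definition cl_mult :: "'n::{finite,linorder} clifford \<Rightarrow> 'n clifford \<Rightarrow> 'n clifford"
    (infixl "\<odot>" 70) where
  "x \<odot> y = (\<Sum>A\<in>UNIV. \<Sum>B\<in>UNIV. (x $ A * y $ B * cl_sign A B) *\<^sub>R cl_basis (sym_diff A B))"

text \<open>\<open>None\<close> plays the role of the index \<open>0\<close>; thus \<open>real ^ ('n option)\<close> is the space of points
  \<open>(x\<^sub>0, \<dots>, x\<^sub>n)\<close>.\<close>

definition cl_gen :: "'n::{finite,linorder} option \<Rightarrow> 'n clifford" where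
  "cl_gen i = (case i of None \<Rightarrow> cl_basis {} | Some j \<Rightarrow> cl_basis {j})"

lemma cl_sign_prod:
  fixes A B :: "'n::{finite,linorder} set"
  shows "cl_sign A B = (\<Prod>a\<in>A. \<Prod>b\<in>B. if b \<le> a then -1 else 1)"
proof -
  have "(\<Prod>a\<in>A. \<Prod>b\<in>B. if b \<le> a then -1 else (1::real))
      = (\<Prod>p\<in>A \<times> B. if snd p \<le> fst p then -1 else 1)"
    by (simp add: prod.cartesian_product case_prod_unfold)
  also have "\<dots> = (\<Prod>p\<in>{p \<in> A \<times> B. snd p \<le> fst p}. -1)"
    by (rule prod.mono_neutral_cong_right) auto
  also have "{p \<in> A \<times> B. snd p \<le> fst p} = {(a, b). a \<in> A \<and> b \<in> B \<and> b \<le> a}"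
    by auto
  finally show ?thesis
    by (simp add: cl_sign_def)
qed

lemma prod_sym_diff:
  fixes f :: "'b::finite \<Rightarrow> real"
  assumes "\<And>x. f x * f x = 1"
  shows "prod f (sym_diff A B) = prod f A * prod f B"
proof -
  have A: "prod f A = prod f (A - B) * prod f (A \<inter> B)"
    by (subst prod.union_disjoint [symmetric]) (auto intro!: prod.cong)
  have B: "prod f B = prod f (B - A) * prod f (A \<inter> B)"
    by (subst prod.union_disjoint [symmetric]) (auto intro!: prod.cong)
  have "prod f (A \<inter> B) * prod f (A \<inter> B) = 1"
    by (simp add: prod.distrib [symmetric] assms)
  then have "prod f A * prod f B = prod f (A - B) * prod f (B - A)"
    unfolding A B by (simp add: mult.assoc mult.left_commute)
  also have "\<dots> = prod f (sym_diff A B)"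
    by (rule prod.union_disjoint [symmetric]) auto
  finally show ?thesis ..
qed

lemma cl_sign_sym_diff_left: "cl_sign (sym_diff A B) C = cl_sign A C * cl_sign B C"
  unfolding cl_sign_prod by (rule prod_sym_diff) (auto simp flip: prod.distrib intro!: prod.neutral)

lemma cl_sign_sym_diff_right: "cl_sign A (sym_diff B C) = cl_sign A B * cl_sign A C"
proof -
  have *: "(\<Prod>b\<in>sym_diff B C. if b \<le> a then -1 else (1::real))
      = (\<Prod>b\<in>B. if b \<le> a then -1 else 1) * (\<Prod>b\<in>C. if b \<le> a then -1 else 1)" for a
    by (rule prod_sym_diff) simp
  show ?thesis
    unfolding cl_sign_prod * by (simp add: prod.distrib)
qed

lemma cl_mult_basis: "cl_basis A \<odot> cl_basis B = cl_sign A B *\<^sub>R cl_basis (sym_diff A B)"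
proof -
  have "cl_basis A \<odot> cl_basis B = (\<Sum>A'\<in>UNIV. \<Sum>B'\<in>UNIV. if A' = A \<and> B' = B
      then cl_sign A B *\<^sub>R cl_basis (sym_diff A B) else 0)"
    unfolding cl_mult_def by (intro sum.cong refl) (auto simp: cl_basis_def axis_def)
  also have "\<dots> = (\<Sum>A'\<in>UNIV. if A' = A then cl_sign A B *\<^sub>R cl_basis (sym_diff A B) else 0)"
    by (intro sum.cong refl) (auto simp: sum.delta)
  finally show ?thesis
    by (simp add: sum.delta)
qed

lemma cl_expand: "x = (\<Sum>A\<in>UNIV. (x $ A) *\<^sub>R cl_basis A)"
  by (simp add: vec_eq_iff cl_basis_def axis_def if_distrib [of "\<lambda>t. _ * t"] sum.delta' cong: if_cong)

lemma bilinear_cl_mult: "bilinear (\<odot>)"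
  unfolding bilinear_def cl_mult_def
  by (auto intro!: linearI
      simp: algebra_simps sum.distrib scaleR_sum_right)

interpretation cl_mult: bounded_bilinear "(\<odot>)"
  using bilinear_cl_mult by (simp add: bilinear_conv_bounded_bilinear)

lemma cl_mult_assoc: "(x \<odot> y) \<odot> z = x \<odot> (y \<odot> z)"
proof -
  have basis: "(cl_basis A \<odot> cl_basis B) \<odot> cl_basis C = cl_basis A \<odot> (cl_basis B \<odot> cl_basis C)"
    for A B C :: "'a set"
  proof -
    have "sym_diff (sym_diff A B) C = sym_diff A (sym_diff B C)"
      by blast
    then show ?thesis
      by (simp add: cl_mult_basis cl_mult.scaleR_left cl_mult.scaleR_right
          cl_sign_sym_diff_left cl_sign_sym_diff_right mult_ac)
  qed
  have "(x \<odot> y) \<odot> z = ((\<Sum>A\<in>UNIV. (x $ A) *\<^sub>R cl_basis A) \<odot> (\<Sum>A\<in>UNIV. (y $ A) *\<^sub>R cl_basis A))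
      \<odot> (\<Sum>A\<in>UNIV. (z $ A) *\<^sub>R cl_basis A)"
    by (simp flip: cl_expand)
  also have "\<dots> = (\<Sum>A\<in>UNIV. (x $ A) *\<^sub>R cl_basis A) \<odot> ((\<Sum>A\<in>UNIV. (y $ A) *\<^sub>R cl_basis A)
      \<odot> (\<Sum>A\<in>UNIV. (z $ A) *\<^sub>R cl_basis A))"
    by (simp add: cl_mult.sum_left cl_mult.sum_right cl_mult.scaleR_left cl_mult.scaleR_right basis)
  finally show ?thesis
    by (simp flip: cl_expand)
qed

lemma cl_mult_1_left: "cl_gen None \<odot> x = x"
  and cl_mult_1_right: "x \<odot> cl_gen None = x"
proof -
  have "cl_basis {} \<odot> (\<Sum>A\<in>UNIV. (x $ A) *\<^sub>R cl_basis A) = (\<Sum>A\<in>UNIV. (x $ A) *\<^sub>R cl_basis A)"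
    by (simp add: cl_mult.sum_right cl_mult.scaleR_right cl_mult_basis cl_sign_def)
  then show "cl_gen None \<odot> x = x"
    by (simp add: cl_gen_def flip: cl_expand)
  have "(\<Sum>A\<in>UNIV. (x $ A) *\<^sub>R cl_basis A) \<odot> cl_basis {} = (\<Sum>A\<in>UNIV. (x $ A) *\<^sub>R cl_basis A)"
    by (simp add: cl_mult.sum_left cl_mult.scaleR_left cl_mult_basis cl_sign_def)
  then show "x \<odot> cl_gen None = x"
    by (simp add: cl_gen_def flip: cl_expand)
qed

lemma cl_gen_square: "cl_gen (Some i) \<odot> cl_gen (Some i) = - cl_gen None"
  by (simp add: cl_gen_def cl_mult_basis cl_sign_prod)

lemma cl_gen_anticommute:
  assumes "i \<noteq> j"
  shows "cl_gen (Some i) \<odot> cl_gen (Some j) + cl_gen (Some j) \<odot> cl_gen (Some i) = 0"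
proof -
  have "sym_diff {i} {j} = {i, j}" "sym_diff {j} {i} = {i, j}"
    using assms by auto
  then show ?thesis
    using assms by (auto simp: cl_gen_def cl_mult_basis cl_sign_prod)
qed

lemma cl_basis_insert:
  assumes "\<And>b. b \<in> B \<Longrightarrow> a < b"
  shows "cl_basis (insert a B) = cl_gen (Some a) \<odot> cl_basis B"
proof -
  have "sym_diff {a} B = insert a B"
    using assms by auto
  moreover have "cl_sign {a} B = 1"
    unfolding cl_sign_prod using assms by (auto intro!: prod.neutral simp: not_le)
  ultimately show ?thesis
    by (simp add: cl_gen_def cl_mult_basis)
qed

lemma cl_basis_eq_product:
  "cl_basis A = foldr (\<lambda>i x. cl_gen (Some i) \<odot> x) (sorted_list_of_set A) (cl_gen None)"
proof -
  have "cl_basis (set xs) = foldr (\<lambda>i x. cl_gen (Some i) \<odot> x) xs (cl_gen None)"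
    if "sorted_wrt (<) xs" for xs :: "'a list"
    using that by (induction xs) (auto simp: cl_gen_def [of None] cl_basis_insert)
  from this [of "sorted_list_of_set A"] show ?thesis
    by simp
qed


section \<open>Function spaces, the Cauchy--Riemann operator and weak solutions\<close>

definition partial_deriv :: "'i::finite \<Rightarrow> (real ^ 'i \<Rightarrow> real) \<Rightarrow> real ^ 'i \<Rightarrow> real" where
  "partial_deriv i h x = deriv (\<lambda>t. h (x + t *\<^sub>R axis i 1)) 0"

primrec C_k :: "nat \<Rightarrow> (real ^ 'i::finite \<Rightarrow> real) \<Rightarrow> bool" where
  "C_k 0 h \<longleftrightarrow> continuous_on UNIV h"
| "C_k (Suc k) h \<longleftrightarrow> (\<forall>x. h differentiable (at x)) \<and> (\<forall>i. C_k k (partial_deriv i h))"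

definition smooth :: "(real ^ 'i::finite \<Rightarrow> real) \<Rightarrow> bool" where
  "smooth h \<longleftrightarrow> (\<forall>k. C_k k h)"

text \<open>Test functions on \<open>\<Omega>\<close> are identified with their extension by zero to the whole space.\<close>

definition test_functions ::
    "(real ^ ('n option)) set \<Rightarrow> (real ^ ('n option) \<Rightarrow> 'n::{finite,linorder} clifford) set" where
  "test_functions \<Omega> = {\<alpha>. \<forall>A. smooth (\<lambda>x. \<alpha> x $ A) \<and>
      compact (closure {x. \<alpha> x $ A \<noteq> 0}) \<and> closure {x. \<alpha> x $ A \<noteq> 0} \<subseteq> \<Omega>}"

text \<open>Functions on \<open>\<Omega>\<close> are total functions whose values off \<open>\<Omega>\<close> are irrelevant.\<close>

definition L2 ::
    "(real ^ ('n option)) set \<Rightarrow> (real ^ ('n option) \<Rightarrow> 'n::{finite,linorder} clifford) set" where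
  "L2 \<Omega> = {f. \<forall>A. (\<lambda>x. f x $ A) \<in> borel_measurable (lebesgue_on \<Omega>) \<and>
      integrable (lebesgue_on \<Omega>) (\<lambda>x. (f x $ A)\<^sup>2)}"

definition Dbar_left ::
    "(real ^ ('n option) \<Rightarrow> 'n::{finite,linorder} clifford) \<Rightarrow> real ^ ('n option) \<Rightarrow> 'n clifford" where
  "Dbar_left g x = (\<Sum>i\<in>UNIV. \<Sum>A\<in>UNIV. partial_deriv i (\<lambda>y. g y $ A) x *\<^sub>R (cl_gen i \<odot> cl_basis A))"

definition Dbar_right ::
    "(real ^ ('n option) \<Rightarrow> 'n::{finite,linorder} clifford) \<Rightarrow> real ^ ('n option) \<Rightarrow> 'n clifford" where
  "Dbar_right g x = (\<Sum>i\<in>UNIV. \<Sum>A\<in>UNIV. partial_deriv i (\<lambda>y. g y $ A) x *\<^sub>R (cl_basis A \<odot> cl_gen i))"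

definition weak_Dbar_solution ::
    "(real ^ ('n option)) set \<Rightarrow> (real ^ ('n option) \<Rightarrow> 'n::{finite,linorder} clifford) \<Rightarrow>
      (real ^ ('n option) \<Rightarrow> 'n clifford) \<Rightarrow> bool" where
  "weak_Dbar_solution \<Omega> u f \<longleftrightarrow> (\<forall>\<alpha>\<in>test_functions \<Omega>.
      (LINT x|lebesgue_on \<Omega>. \<alpha> x \<odot> f x) = - (LINT x|lebesgue_on \<Omega>. Dbar_right \<alpha> x \<odot> u x))"

end

theory Submission
  imports Defs
begin

text \<open>
  Right multiplication by \<open>e\<^sub>j\<close> is skew for the Euclidean inner product of coordinates, and
  \<open>\<integral> \<partial>\<^sub>0 a \<partial>\<^sub>j b = \<integral> \<partial>\<^sub>j a \<partial>\<^sub>0 b\<close> for compactly supported \<open>a\<close>, \<open>b\<close>; hence the cross terms in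
  \<open>\<integral> \<partial>\<^sub>0 \<alpha> \<bullet> (\<alpha> Dbar)\<close> vanish and \<open>\<parallel>\<partial>\<^sub>0 \<alpha>\<parallel> \<le> \<parallel>\<alpha> Dbar\<parallel>\<close> in \<open>L\<^sup>2\<close>. With the Poincare inequality in direction
  \<open>x\<^sub>0\<close> on the bounded set \<open>\<Omega>\<close> this yields \<open>\<parallel>\<alpha>\<parallel> \<le> C \<parallel>\<alpha> Dbar\<parallel>\<close> for all test functions. Therefore the scalar part
  of \<open>- \<integral> \<alpha> f\<close> is a bounded functional of \<open>\<alpha> Dbar\<close>, and its Riesz representative gives \<open>u\<close>. Replacing \<open>\<alpha>\<close> by
  \<open>e\<^sub>C \<alpha>\<close> recovers the other components.
\<close>

section \<open>Integration by parts via difference quotients\<close>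

text \<open>Continuity is part of the notion, so integrability and boundedness follow at once. Any
  compact \<open>K\<close> outside which \<open>f\<close> vanishes is accepted, which avoids
  computing closures of supports.\<close>

definition compactly_supported :: "('a::metric_space \<Rightarrow> 'b::real_normed_vector) \<Rightarrow> bool" where
  "compactly_supported f \<longleftrightarrow> continuous_on UNIV f \<and> (\<exists>K. compact K \<and> (\<forall>x. x \<notin> K \<longrightarrow> f x = 0))"

lemma compactly_supportedI:
  "continuous_on UNIV f \<Longrightarrow> compact K \<Longrightarrow> (\<And>x. x \<notin> K \<Longrightarrow> f x = 0) \<Longrightarrow> compactly_supported f"
  by (auto simp: compactly_supported_def)

lemma compactly_supported_continuous: "compactly_supported f \<Longrightarrow> continuous_on UNIV f"
  by (auto simp: compactly_supported_def)

lemma compactly_supported_integrable: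
  fixes f :: "'a::euclidean_space \<Rightarrow> 'b::{banach, second_countable_topology}"
  assumes "compactly_supported f"
  shows "integrable lborel f"
proof -
  obtain K where K: "compact K" "\<And>x. x \<notin> K \<Longrightarrow> f x = 0" and f: "continuous_on UNIV f"
    using assms by (auto simp: compactly_supported_def)
  have "integrable lborel (\<lambda>x. indicator K x *\<^sub>R f x)"
    by (rule borel_integrable_compact[OF K(1)]) (use f continuous_on_subset in blast)
  also have "(\<lambda>x. indicator K x *\<^sub>R f x) = f"
    using K(2) by (auto simp: fun_eq_iff indicator_def)
  finally show ?thesis .
qed

lemma compactly_supported_mult_left:
  fixes f g :: "'a::metric_space \<Rightarrow> real"
  assumes "compactly_supported f" "continuous_on UNIV g"
  shows "compactly_supported (\<lambda>x. f x * g x)"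
  using assms by (fastforce simp: compactly_supported_def intro!: continuous_intros)

lemma compactly_supported_translate:
  fixes f :: "'a::euclidean_space \<Rightarrow> 'b::real_normed_vector"
  assumes "compactly_supported f"
  shows "compactly_supported (\<lambda>x. f (x + d))"
proof -
  obtain K where K: "compact K" "\<And>x. x \<notin> K \<Longrightarrow> f x = 0" and f: "continuous_on UNIV f"
    using assms by (auto simp: compactly_supported_def)
  show ?thesis
  proof (rule compactly_supportedI)
    show "continuous_on UNIV (\<lambda>x. f (x + d))"
      by (intro continuous_on_compose2[OF f] continuous_intros) auto
    show "compact ((\<lambda>x. - d + x) ` K)" by (rule compact_translation[OF K(1)])
    fix x assume x: "x \<notin> (\<lambda>x. - d + x) ` K"
    have "x + d \<notin> K"
    proof
      assume "x + d \<in> K"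
      then have "- d + (x + d) \<in> (\<lambda>x. - d + x) ` K" by blast
      with x show False by simp
    qed
    then show "f (x + d) = 0" by (rule K(2))
  qed
qed

lemma lborel_integral_translate:
  fixes f :: "'a::euclidean_space \<Rightarrow> real"
  assumes "f \<in> borel_measurable borel"
  shows "(LINT x|lborel. f (x + d)) = (LINT x|lborel. f x)"
proof -
  have "(LINT x|lborel. f x) = (LINT x|distr lborel borel ((+) d). f x)"
    by (simp add: lborel_distr_plus)
  also have "\<dots> = (LINT x|lborel. f (d + x))"
    using assms by (intro integral_distr) auto
  finally show ?thesis by (simp add: add.commute)
qed

text \<open>A relation between a function and its derivative along \<open>v\<close> at all points.
  Only one-variable calculus on the lines parallel to \<open>v\<close> enters; continuity of
  \<open>c\<close> and \<open>c'\<close> is assumed separately where it matters.\<close>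

definition directional_deriv ::
    "'a::real_normed_vector \<Rightarrow> ('a \<Rightarrow> real) \<Rightarrow> ('a \<Rightarrow> real) \<Rightarrow> bool" where
  "directional_deriv v c c' \<longleftrightarrow>
    (\<forall>x. ((\<lambda>t. c (x + t *\<^sub>R v)) has_real_derivative c' x) (at 0))"

text \<open>The derivative at parameter \<open>s\<close> is the derivative at 0 on the same line
  restarted at \<open>x + s *\<^sub>R v\<close>.\<close>

lemma directional_derivD:
  assumes "directional_deriv v c c'"
  shows "((\<lambda>t. c (x + t *\<^sub>R v)) has_real_derivative c' (x + s *\<^sub>R v)) (at s)"
proof -
  have "((\<lambda>t. c ((x + s *\<^sub>R v) + t *\<^sub>R v)) has_real_derivative c' (x + s *\<^sub>R v)) (at (s - s))"
    using assms by (simp add: directional_deriv_def)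
  then have "((\<lambda>t. c ((x + s *\<^sub>R v) + (t - s) *\<^sub>R v)) has_real_derivative c' (x + s *\<^sub>R v)) (at s)"
    using DERIV_shift[of "\<lambda>t. c ((x + s *\<^sub>R v) + t *\<^sub>R v)" "c' (x + s *\<^sub>R v)" s "- s"] by simp
  then show ?thesis by (simp add: algebra_simps)
qed

lemma directional_deriv_mult:
  assumes "directional_deriv v a a'" "directional_deriv v b b'"
  shows "directional_deriv v (\<lambda>x. a x * b x) (\<lambda>x. a' x * b x + a x * b' x)"
  unfolding directional_deriv_def
proof
  fix x
  show "((\<lambda>t. a (x + t *\<^sub>R v) * b (x + t *\<^sub>R v)) has_real_derivative
      a' x * b x + a x * b' x) (at 0)"
    using DERIV_mult[of "\<lambda>t. a (x + t *\<^sub>R v)" "a' x" 0 UNIV "\<lambda>t. b (x + t *\<^sub>R v)" "b' x"]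
      assms by (simp add: directional_deriv_def algebra_simps)
qed

lemma directional_deriv_translate:
  "directional_deriv v c c' \<Longrightarrow> directional_deriv v (\<lambda>x. c (x + d)) (\<lambda>x. c' (x + d))"
proof -
  assume c: "directional_deriv v c c'"
  have "((\<lambda>t. c ((x + d) + t *\<^sub>R v)) has_real_derivative c' (x + d)) (at 0)" for x
    using c by (simp add: directional_deriv_def)
  then show ?thesis
    by (simp add: directional_deriv_def algebra_simps)
qed

text \<open>The complement of \<open>K\<close> is open, so \<open>c\<close> vanishes on the line
  through \<open>x\<close> for all small parameters.\<close>

lemma directional_deriv_zero_outside:
  assumes "directional_deriv v c c'" "closed K" "\<And>x. x \<notin> K \<Longrightarrow> c x = 0" "x \<notin> K"
  shows "c' x = 0"
proof -
  have 1: "((\<lambda>t. c (x + t *\<^sub>R v)) has_real_derivative c' x) (at 0)"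
    using assms(1) by (simp add: directional_deriv_def)
  have "open ((\<lambda>t. x + t *\<^sub>R v) -` (- K))"
    using assms(2) by (intro open_vimage continuous_intros) auto
  then have "eventually (\<lambda>t. t \<in> (\<lambda>t. x + t *\<^sub>R v) -` (- K)) (nhds 0)"
    using assms(4) by (intro eventually_nhds_in_open) auto
  then have "eventually (\<lambda>t. c (x + t *\<^sub>R v) = 0) (nhds 0)"
    by eventually_elim (use assms(3) in auto)
  then have "((\<lambda>t. 0) has_real_derivative c' x) (at 0)"
    using 1 DERIV_cong_ev[of 0 0 "\<lambda>t. c (x + t *\<^sub>R v)" "\<lambda>t. 0" "c' x" "c' x"] by simp
  then show ?thesis
    using DERIV_unique DERIV_const by blast
qed

lemma compactly_supported_directional_deriv:
  assumes "compactly_supported c" "directional_deriv v c c'" "continuous_on UNIV c'"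
  shows "compactly_supported c'"
proof -
  obtain K where "compact K" "\<And>x. x \<notin> K \<Longrightarrow> c x = 0"
    using assms by (auto simp: compactly_supported_def)
  then show ?thesis
    using directional_deriv_zero_outside[OF assms(2) compact_imp_closed[of K]] assms(3)
    by (auto intro: compactly_supportedI)
qed

lemma compactly_supported_bounded:
  assumes "compactly_supported f"
  obtains B where "\<And>x. norm (f x) \<le> B"
proof -
  obtain K where K: "compact K" "\<And>x. x \<notin> K \<Longrightarrow> f x = 0" and f: "continuous_on UNIV f"
    using assms by (auto simp: compactly_supported_def)
  have "compact (f ` K)"
    using K(1) f by (meson compact_continuous_image continuous_on_subset subset_UNIV)
  then obtain B where B: "\<forall>y\<in>f ` K. norm y \<le> B"
    using compact_imp_bounded bounded_iff by blast
  have "norm (f x) \<le> max B 0" for x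
    using B K(2)[of x] by (cases "x \<in> K") (auto simp: le_max_iff_disj)
  then show ?thesis using that by blast
qed

section \<open>Limits of difference quotients under the integral\<close>

lemma difference_quotient_bound:
  assumes "directional_deriv v c c'" "\<And>x. \<bar>c' x\<bar> \<le> M"
  shows "\<bar>(c (x + h *\<^sub>R v) - c x) / h\<bar> \<le> M"
proof (cases "h = 0")
  case True
  \<comment> \<open>Division by zero yields 0, so only \<open>0 \<le> M\<close> remains, which the
    bound at \<open>x\<close> gives.\<close>
  then show ?thesis using assms(2)[of x] by simp
next
  case False
  have "norm (c (x + h *\<^sub>R v) - c (x + 0 *\<^sub>R v)) \<le> M * norm (h - 0)"
    by (rule field_differentiable_bound[where S=UNIV and f="\<lambda>t. c (x + t *\<^sub>R v)"
          and f'="\<lambda>t. c' (x + t *\<^sub>R v)"]) (use directional_derivD[OF assms(1)] assms(2) in auto)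
  then show ?thesis using False by (simp add: field_simps abs_divide)
qed

text \<open>Dominated convergence: the mean value bound controls the quotients uniformly, and for
  steps of size at most 1 they all live on one compact set. The weight \<open>g\<close> only has to
  be continuous.\<close>

lemma integral_difference_quotient_tendsto:
  fixes c c' g :: "'a::euclidean_space \<Rightarrow> real" and h :: "nat \<Rightarrow> real"
  assumes c: "compactly_supported c" and der: "directional_deriv v c c'"
    and c': "continuous_on UNIV c'" and g: "continuous_on UNIV g"
    and h: "h \<longlonglongrightarrow> 0" "\<And>m. h m \<noteq> 0" "\<And>m. \<bar>h m\<bar> \<le> 1"
  shows "(\<lambda>m. LINT x|lborel. g x * ((c (x + h m *\<^sub>R v) - c x) / h m)) \<longlonglongrightarrow> (LINT x|lborel. g x * c' x)"
proof -
  obtain K where K: "compact K" "\<And>x. x \<notin> K \<Longrightarrow> c x = 0" and cc: "continuous_on UNIV c"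
    using c by (auto simp: compactly_supported_def)
  obtain M where M: "\<And>x. \<bar>c' x\<bar> \<le> M"
    using compactly_supported_bounded[OF compactly_supported_directional_deriv[OF c der c']]
    by auto
  \<comment> \<open>The set swept out by \<open>K\<close> when it moves by at most one step along
    \<open>v\<close>. Outside it both \<open>c x\<close> and \<open>c (x + h m *\<^sub>R v)\<close>
    vanish.\<close>
  define K' where "K' = (\<lambda>(t, x). x - t *\<^sub>R v) ` ({-1..1} \<times> K)"
  have K': "compact K'"
    unfolding K'_def
    by (intro compact_continuous_image compact_Times K compact_Icc)
      (auto intro!: continuous_intros simp: case_prod_unfold)
  have out: "c (x + t *\<^sub>R v) = 0" if "x \<notin> K'" "\<bar>t\<bar> \<le> 1" for x t
  proof (rule K(2))
    show "x + t *\<^sub>R v \<notin> K"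
    proof
      assume "x + t *\<^sub>R v \<in> K"
      then have "(\<lambda>(t, x). x - t *\<^sub>R v) (t, x + t *\<^sub>R v) \<in> K'"
        unfolding K'_def using that(2) by (intro imageI) auto
      with that(1) show False by simp
    qed
  qed
  have gm: "g \<in> borel_measurable borel" and cm: "c \<in> borel_measurable borel"
    and c'm: "c' \<in> borel_measurable borel"
    using g cc c' by (auto intro: borel_measurable_continuous_onI)
  note [measurable] = gm cm c'm
  define w where "w x = indicator K' x *\<^sub>R (\<bar>g x\<bar> * M)" for x
  show ?thesis
  proof (rule integral_dominated_convergence[where w = w])
    show "integrable lborel w"
      unfolding w_def using g
      by (intro borel_integrable_compact[OF K'])
        (auto intro!: continuous_intros intro: continuous_on_subset)
    show "(\<lambda>x. g x * c' x) \<in> borel_measurable lborel"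
      by measurable
    show "(\<lambda>x. g x * ((c (x + h m *\<^sub>R v) - c x) / h m)) \<in> borel_measurable lborel" for m
      by measurable
    show "AE x in lborel. (\<lambda>m. g x * ((c (x + h m *\<^sub>R v) - c x) / h m)) \<longlonglongrightarrow> g x * c' x"
    proof (intro AE_I2 tendsto_mult tendsto_const)
      fix x
      have "((\<lambda>t. (c (x + t *\<^sub>R v) - c (x + 0 *\<^sub>R v)) / (t - 0)) \<longlongrightarrow> c' x) (at 0)"
        using der[unfolded directional_deriv_def, rule_format, of x, unfolded has_field_derivative_iff]
        by simp
      moreover have "filterlim h (at 0) sequentially"
        using h by (auto simp: filterlim_at)
      ultimately have "(\<lambda>m. (c (x + h m *\<^sub>R v) - c (x + 0 *\<^sub>R v)) / (h m - 0)) \<longlonglongrightarrow> c' x"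
        by (rule filterlim_compose)
      then show "(\<lambda>m. (c (x + h m *\<^sub>R v) - c x) / h m) \<longlonglongrightarrow> c' x" by simp
    qed
    show "AE x in lborel. norm (g x * ((c (x + h m *\<^sub>R v) - c x) / h m)) \<le> w x" for m
    proof (intro AE_I2)
      fix x
      show "norm (g x * ((c (x + h m *\<^sub>R v) - c x) / h m)) \<le> w x"
      proof (cases "x \<in> K'")
        case True
        have "\<bar>(c (x + h m *\<^sub>R v) - c x) / h m\<bar> \<le> M"
          by (rule difference_quotient_bound[OF der M])
        then have "\<bar>g x\<bar> * \<bar>(c (x + h m *\<^sub>R v) - c x) / h m\<bar> \<le> \<bar>g x\<bar> * M"
          by (rule mult_left_mono) simp
        then show ?thesis using True by (simp add: w_def abs_mult)
      next
        case False
        then show ?thesis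
          using out[OF False h(3)[of m]] out[OF False, of 0] by (simp add: w_def)
      qed
    qed
  qed
qed

lemma inverse_Suc_null_sequence:
  "(\<lambda>m. 1 / real (Suc m)) \<longlonglongrightarrow> 0" "1 / real (Suc m) \<noteq> 0" "\<bar>1 / real (Suc m)\<bar> \<le> 1"
  using LIMSEQ_inverse_real_of_nat by (auto simp: inverse_eq_divide)

text \<open>Translation invariance makes the integral of every difference quotient zero, and this
  passes to the limit.\<close>

lemma integral_directional_deriv_eq_0:
  fixes c c' :: "'a::euclidean_space \<Rightarrow> real"
  assumes c: "compactly_supported c" and der: "directional_deriv v c c'" and c': "continuous_on UNIV c'"
  shows "(LINT x|lborel. c' x) = 0"
proof -
  \<comment> \<open>The factor 1 is the weight \<open>g\<close> of the convergence lemma.\<close>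
  have "(LINT x|lborel. 1 * ((c (x + h *\<^sub>R v) - c x) / h)) = 0" for h
  proof -
    have "(LINT x|lborel. c (x + h *\<^sub>R v) - c x) = 0"
      using c lborel_integral_translate[of c "h *\<^sub>R v"]
      by (subst Bochner_Integration.integral_diff)
        (auto intro!: compactly_supported_integrable compactly_supported_translate
          borel_measurable_continuous_onI compactly_supported_continuous)
    then show ?thesis by simp
  qed
  then have "(\<lambda>m. 0) \<longlonglongrightarrow> (LINT x|lborel. 1 * c' x)"
    using integral_difference_quotient_tendsto[OF c der c' _ inverse_Suc_null_sequence, of "\<lambda>x. 1"]
    by (simp only: continuous_on_const)
  then show ?thesis by (simp add: LIMSEQ_const_iff)
qed

text \<open>The product rule for \<open>a\<close> times \<open>b\<close>, whose derivative has
  integral zero. Compact support is asked of \<open>a\<close> alone, so \<open>b\<close> may be a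
  coordinate function, as in the Poincare inequality.\<close>

lemma integral_by_parts_directional:
  fixes a a' b b' :: "'a::euclidean_space \<Rightarrow> real"
  assumes a: "compactly_supported a" "directional_deriv v a a'" "continuous_on UNIV a'"
    and b: "continuous_on UNIV b" "directional_deriv v b b'" "continuous_on UNIV b'"
  shows "(LINT x|lborel. a' x * b x) = - (LINT x|lborel. a x * b' x)"
proof -
  have "compactly_supported a'"
    using compactly_supported_directional_deriv[OF a] .
  then have int: "integrable lborel (\<lambda>x. a' x * b x)" "integrable lborel (\<lambda>x. a x * b' x)"
    using a b by (auto intro!: compactly_supported_integrable compactly_supported_mult_left)
  have "(LINT x|lborel. a' x * b x + a x * b' x) = 0"
    using a b by (intro integral_directional_deriv_eq_0[OF _ directional_deriv_mult[OF a(2) b(2)]]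
      compactly_supported_mult_left continuous_intros compactly_supported_continuous[OF a(1)]) auto
  then show ?thesis using int by (simp add: Bochner_Integration.integral_add)
qed

text \<open>Difference quotients in direction \<open>w\<close> replace second derivatives, so \<open>C\<^sup>1\<close> suffices.\<close>

lemma integral_directional_deriv_swap:
  fixes a b :: "'a::euclidean_space \<Rightarrow> real"
  assumes a: "compactly_supported a" "directional_deriv v a av" "continuous_on UNIV av"
      "directional_deriv w a aw" "continuous_on UNIV aw"
    and b: "compactly_supported b" "directional_deriv v b bv" "continuous_on UNIV bv"
      "directional_deriv w b bw" "continuous_on UNIV bw"
  shows "(LINT x|lborel. av x * bw x) = (LINT x|lborel. aw x * bv x)"
proof -
  note ac = compactly_supported_continuous[OF a(1)] and bc = compactly_supported_continuous[OF b(1)]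
  have avc: "compactly_supported av" using compactly_supported_directional_deriv[OF a(1-3)] .
  have bvc: "compactly_supported bv" using compactly_supported_directional_deriv[OF b(1-3)] .
  have tr: "continuous_on UNIV (\<lambda>x. f (x + d))" if "continuous_on UNIV f" for f :: "'a \<Rightarrow> real" and d
    by (intro continuous_on_compose2[OF that] continuous_intros) auto
  \<comment> \<open>The discrete form of the claim: integration by parts along \<open>v\<close>
    moves the derivative from \<open>a\<close> to \<open>b\<close>, and a translation by
    \<open>- h\<close> along \<open>w\<close> moves the shift from \<open>b\<close> to
    \<open>a\<close>. The minus sign is absorbed by the step \<open>- h\<close> of the new
    quotient.\<close>
  have eq: "(LINT x|lborel. av x * ((b (x + h *\<^sub>R w) - b x) / h))
      = (LINT x|lborel. bv x * ((a (x + (- h) *\<^sub>R w) - a x) / (- h)))" for h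
  proof -
    have int: "integrable lborel (\<lambda>x. av x * b (x + h *\<^sub>R w))" "integrable lborel (\<lambda>x. av x * b x)"
       "integrable lborel (\<lambda>x. bv x * a (x + (- h) *\<^sub>R w))" "integrable lborel (\<lambda>x. bv x * a x)"
      using avc bvc ac bc tr
      by (auto intro!: compactly_supported_integrable compactly_supported_mult_left simp del: scaleR_minus_left)
    have 1: "(LINT x|lborel. av x * b (x + h *\<^sub>R w)) = - (LINT x|lborel. bv x * a (x + (- h) *\<^sub>R w))"
    proof -
      have "(LINT x|lborel. av x * b (x + h *\<^sub>R w)) = - (LINT x|lborel. a x * bv (x + h *\<^sub>R w))"
        using a b bc tr directional_deriv_translate
        by (intro integral_by_parts_directional) auto
      also have "(LINT x|lborel. a x * bv (x + h *\<^sub>R w))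
          = (LINT x|lborel. a ((x + h *\<^sub>R w) + (- h) *\<^sub>R w) * bv (x + h *\<^sub>R w))"
        by simp
      also have "\<dots> = (LINT x|lborel. a (x + (- h) *\<^sub>R w) * bv x)"
        using ac b(3) tr
        by (intro lborel_integral_translate[of "\<lambda>x. a (x + (- h) *\<^sub>R w) * bv x"]
            borel_measurable_continuous_onI continuous_intros)
      finally show ?thesis by (simp only: mult.commute)
    qed
    have 2: "(LINT x|lborel. av x * b x) = - (LINT x|lborel. bv x * a x)"
      using integral_by_parts_directional[OF a(1-3) bc b(2,3)] by (simp add: mult.commute)
    have "(LINT x|lborel. av x * ((b (x + h *\<^sub>R w) - b x) / h))
        = (LINT x|lborel. (av x * b (x + h *\<^sub>R w) - av x * b x) / h)"
      by (simp add: algebra_simps)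
    also have "\<dots> = ((LINT x|lborel. av x * b (x + h *\<^sub>R w)) - (LINT x|lborel. av x * b x)) / h"
      using int by simp
    also have "\<dots> = ((LINT x|lborel. bv x * a (x + (- h) *\<^sub>R w)) - (LINT x|lborel. bv x * a x)) / (- h)"
      unfolding 1 2 by (simp only: minus_diff_minus divide_minus_right minus_divide_left)
    also have "\<dots> = (LINT x|lborel. (bv x * a (x + (- h) *\<^sub>R w) - bv x * a x) / (- h))"
      using int by (simp del: scaleR_minus_left)
    also have "\<dots> = (LINT x|lborel. bv x * ((a (x + (- h) *\<^sub>R w) - a x) / (- h)))"
      by (simp only: right_diff_distrib times_divide_eq_right)
    finally show ?thesis .
  qed
  define h where "h m = 1 / real (Suc m)" for m
  have h: "h \<longlonglongrightarrow> 0" "h m \<noteq> 0" "\<bar>h m\<bar> \<le> 1" for m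
    using inverse_Suc_null_sequence unfolding h_def by blast+
  have mh: "(\<lambda>m. - h m) \<longlonglongrightarrow> 0" "- h m \<noteq> 0" "\<bar>- h m\<bar> \<le> 1" for m
    using tendsto_minus[OF h(1)] h(2,3) by auto
  \<comment> \<open>The two sides of \<open>eq\<close> are the same sequence; its limit is computed
    with steps \<open>h m\<close> on the left and \<open>- h m\<close> on the right.\<close>
  have "(LINT x|lborel. av x * bw x) = (LINT x|lborel. bv x * aw x)"
    using integral_difference_quotient_tendsto[OF b(1,4,5) a(3) h]
      integral_difference_quotient_tendsto[OF a(1,4,5) b(3) mh]
    unfolding eq by (rule LIMSEQ_unique)
  then show ?thesis by (simp add: mult.commute)
qed

section \<open>Riesz representation in \<open>L\<^sup>2\<close>\<close>

text \<open>The difference of the two sides is the squared norm of \<open>a - b\<close>.\<close>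

lemma norm_add_sq_le: "(norm (a + b))\<^sup>2 \<le> 2 * (norm a)\<^sup>2 + 2 * (norm (b :: 'b::real_inner))\<^sup>2"
  using inner_ge_zero[of "a - b"]
  by (simp add: power2_norm_eq_inner inner_add inner_diff inner_commute)

lemma abs_inner_le_sq: "\<bar>a \<bullet> b\<bar> \<le> (norm a)\<^sup>2 / 2 + (norm (b :: 'b::real_inner))\<^sup>2 / 2"
proof -
  have "0 \<le> (norm a - norm b)\<^sup>2" by simp
  then show ?thesis
    using Cauchy_Schwarz_ineq2[of a b] by (simp add: power2_eq_square algebra_simps)
qed

text \<open>Elements are functions rather than classes modulo null sets. The integral of the squared
  norm thus comes from a seminorm, and convergence is always stated through this integral.\<close>

definition square_integrable :: "'a measure \<Rightarrow> ('a \<Rightarrow> 'b::euclidean_space) \<Rightarrow> bool" where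
  "square_integrable M f \<longleftrightarrow> f \<in> borel_measurable M \<and> integrable M (\<lambda>x. (norm (f x))\<^sup>2)"

lemma square_integrable_add:
  assumes "square_integrable M f" "square_integrable M g"
  shows "square_integrable M (\<lambda>x. f x + g x)"
proof -
  have [measurable]: "f \<in> borel_measurable M" "g \<in> borel_measurable M"
    using assms by (auto simp: square_integrable_def)
  have "integrable M (\<lambda>x. 2 * (norm (f x))\<^sup>2 + 2 * (norm (g x))\<^sup>2)"
    using assms by (auto simp: square_integrable_def)
  then have "integrable M (\<lambda>x. (norm (f x + g x))\<^sup>2)"
    by (rule Bochner_Integration.integrable_bound) (auto simp: norm_add_sq_le)
  then show ?thesis by (simp add: square_integrable_def)
qed

lemma square_integrable_scaleR:
  "square_integrable M f \<Longrightarrow> square_integrable M (\<lambda>x. c *\<^sub>R f x)"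
  by (auto simp: square_integrable_def power_mult_distrib)

lemma square_integrable_diff:
  assumes "square_integrable M f" "square_integrable M g"
  shows "square_integrable M (\<lambda>x. f x - g x)"
  using square_integrable_add[OF assms(1) square_integrable_scaleR[OF assms(2), of "-1"]] by simp

lemma integrable_inner:
  assumes "square_integrable M f" "square_integrable M g"
  shows "integrable M (\<lambda>x. f x \<bullet> g x)"
proof -
  have [measurable]: "f \<in> borel_measurable M" "g \<in> borel_measurable M"
    using assms by (auto simp: square_integrable_def)
  have "integrable M (\<lambda>x. (norm (f x))\<^sup>2 / 2 + (norm (g x))\<^sup>2 / 2)"
    using assms by (auto simp: square_integrable_def)
  then show ?thesis
    by (rule Bochner_Integration.integrable_bound) (auto intro: order_trans[OF abs_inner_le_sq])
qed

text \<open>The expansion of a quadratic form along a line, the source of all the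
  \<open>L\<^sup>2\<close> inequalities below: a well chosen \<open>t\<close> in a nonnegative or
  minimized quadratic gives each bound.\<close>

lemma integral_norm_sq_affine:
  assumes f: "square_integrable M f" and g: "square_integrable M g"
  shows "(LINT x|M. (norm (f x + t *\<^sub>R g x))\<^sup>2) =
    (LINT x|M. (norm (f x))\<^sup>2) + 2 * t * (LINT x|M. f x \<bullet> g x) + t\<^sup>2 * (LINT x|M. (norm (g x))\<^sup>2)"
proof -
  have "(norm (f x + t *\<^sub>R g x))\<^sup>2 = (norm (f x))\<^sup>2 + 2 * t * (f x \<bullet> g x) + t\<^sup>2 * (norm (g x))\<^sup>2" for x
    by (simp only: power2_norm_eq_inner)
      (simp add: inner_add inner_commute power2_eq_square algebra_simps)
  moreover have "integrable M (\<lambda>x. (norm (f x))\<^sup>2)" "integrable M (\<lambda>x. (norm (g x))\<^sup>2)"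
    using f g by (auto simp: square_integrable_def)
  ultimately show ?thesis
    using integrable_inner[OF f g] by simp
qed

text \<open>The Cauchy-Schwarz inequality, weakened by \<open>+ 1\<close> so that the case of a
  vanishing \<open>g\<close> is covered without a distinction. It serves only for passing to
  limits.\<close>

lemma integral_inner_sq_le:
  assumes f: "square_integrable M f" and g: "square_integrable M g"
  shows "(LINT x|M. f x \<bullet> g x)\<^sup>2 \<le> (LINT x|M. (norm (f x))\<^sup>2) * ((LINT x|M. (norm (g x))\<^sup>2) + 1)"
proof -
  define A B G where "A = (LINT x|M. (norm (f x))\<^sup>2)" and "B = (LINT x|M. f x \<bullet> g x)"
    and "G = (LINT x|M. (norm (g x))\<^sup>2)"
  have G: "G \<ge> 0" by (simp add: G_def)
  \<comment> \<open>Nearly the minimizer \<open>- B / G\<close> of the quadratic in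
    \<open>t\<close>, with a denominator that is never zero.\<close>
  define t where "t = - B / (G + 1)"
  have B: "B = - t * (G + 1)" using G by (simp add: t_def)
  have "0 \<le> (LINT x|M. (norm (f x + t *\<^sub>R g x))\<^sup>2)" by simp
  also have "\<dots> = A + 2 * t * B + t\<^sup>2 * G"
    using integral_norm_sq_affine[OF f g] by (simp add: A_def B_def G_def)
  finally have "t\<^sup>2 * (G + 2) \<le> A"
    unfolding B by (simp add: power2_eq_square algebra_simps)
  then have "t\<^sup>2 * (G + 1) \<le> A"
    by (rule order_trans[rotated]) (simp add: mult_left_mono)
  then have "t\<^sup>2 * (G + 1) * (G + 1) \<le> A * (G + 1)"
    using G by (intro mult_right_mono) auto
  then have "B\<^sup>2 \<le> A * (G + 1)"
    by (simp add: B power2_eq_square mult_ac)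
  then show ?thesis by (simp only: A_def B_def G_def)
qed

text \<open>Strong convergence implies weak convergence, by squeezing with the preceding
  inequality.\<close>

lemma integral_inner_tendsto:
  assumes v: "\<And>k. square_integrable M (v k)" and u: "square_integrable M u"
    and lim: "(\<lambda>k. LINT x|M. (norm (v k x - u x))\<^sup>2) \<longlonglongrightarrow> 0"
    and w: "square_integrable M w"
  shows "(\<lambda>k. LINT x|M. v k x \<bullet> w x) \<longlonglongrightarrow> (LINT x|M. u x \<bullet> w x)"
proof -
  define G where "G = (LINT x|M. (norm (w x))\<^sup>2)"
  have eq: "(LINT x|M. (v k x - u x) \<bullet> w x) = (LINT x|M. v k x \<bullet> w x) - (LINT x|M. u x \<bullet> w x)" for k
    using integrable_inner[OF v w] integrable_inner[OF u w]
    by (simp add: inner_diff_left)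
  have "(\<lambda>k. (LINT x|M. (v k x - u x) \<bullet> w x)\<^sup>2) \<longlonglongrightarrow> 0"
  proof (rule tendsto_sandwich[OF _ _ tendsto_const])
    show "(\<lambda>k. (LINT x|M. (norm (v k x - u x))\<^sup>2) * (G + 1)) \<longlonglongrightarrow> 0"
      using tendsto_mult_right[OF lim, of "G + 1"] by simp
    show "\<forall>\<^sub>F k in sequentially. (LINT x|M. (v k x - u x) \<bullet> w x)\<^sup>2
        \<le> (LINT x|M. (norm (v k x - u x))\<^sup>2) * (G + 1)"
      unfolding G_def by (intro always_eventually allI integral_inner_sq_le square_integrable_diff v u w)
  qed auto
  then have "(\<lambda>k. (LINT x|M. (v k x - u x) \<bullet> w x)) \<longlonglongrightarrow> 0"
    using tendsto_real_sqrt by (fastforce simp: tendsto_rabs_zero_iff)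
  then show ?thesis
    unfolding eq by (simp add: LIM_zero_iff)
qed

text \<open>The argument of Riesz and Fischer. The geometric rate replaces the choice of a
  subsequence: on a finite measure space the increments are summable almost everywhere, and Fatou's
  lemma carries the rate over to the pointwise limit.\<close>

lemma L2_complete:
  fixes v :: "nat \<Rightarrow> 'a \<Rightarrow> 'b::euclidean_space"
  assumes "finite_measure M" and v: "\<And>k. square_integrable M (v k)"
    and cauchy: "\<And>j k. k \<le> j \<Longrightarrow> (LINT x|M. (norm (v j x - v k x))\<^sup>2) \<le> (1/4) ^ k"
  obtains u where "square_integrable M u" "(\<lambda>k. LINT x|M. (norm (v k x - u x))\<^sup>2) \<longlonglongrightarrow> 0"
proof -
  interpret finite_measure M by fact
  have vm[measurable]: "v k \<in> borel_measurable M" for k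
    using v by (auto simp: square_integrable_def)
  have dint: "integrable M (\<lambda>x. (norm (v j x - v k x))\<^sup>2)" for j k
    using square_integrable_diff[OF v v] by (auto simp: square_integrable_def)
  define d where "d k x = v (Suc k) x - v k x" for k x
  define m where "m = measure M (space M)"
  \<comment> \<open>The weight \<open>2 ^ k\<close> balances both terms: the squared increment has
    integral at most \<open>(1/4) ^ k\<close>, so each term integrates to a multiple of
    \<open>(1/2) ^ k\<close>.\<close>
  have pw: "norm (d k x) \<le> 2 ^ k * (norm (d k x))\<^sup>2 + (1/2) ^ k" for k x
  proof -
    have "0 \<le> (2 ^ k * norm (d k x) - 1)\<^sup>2" by simp
    then have "2 * (2 ^ k * norm (d k x)) \<le> (2 ^ k)\<^sup>2 * (norm (d k x))\<^sup>2 + 1"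
      by (simp add: power2_diff power_mult_distrib)
    also have "2 * (2 ^ k * norm (d k x)) \<ge> 2 ^ k * norm (d k x)" by simp
    finally have "norm (d k x) \<le> ((2 ^ k)\<^sup>2 * (norm (d k x))\<^sup>2 + 1) / 2 ^ k"
      by (simp add: field_simps)
    then show ?thesis by (simp add: field_simps power2_eq_square)
  qed
  have bint: "integrable M (\<lambda>x. 2 ^ k * (norm (d k x))\<^sup>2 + (1/2) ^ k)" for k
    using dint by (simp add: d_def)
  have nint: "(\<integral>\<^sup>+x. ennreal (norm (d k x)) \<partial>M) \<le> ennreal ((1/2) ^ k * (1 + m))" for k
  proof -
    have "(\<integral>\<^sup>+x. ennreal (norm (d k x)) \<partial>M)
        \<le> (\<integral>\<^sup>+x. ennreal (2 ^ k * (norm (d k x))\<^sup>2 + (1/2) ^ k) \<partial>M)"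
      by (intro nn_integral_mono ennreal_leI pw)
    also have "\<dots> = ennreal (LINT x|M. 2 ^ k * (norm (d k x))\<^sup>2 + (1/2) ^ k)"
      using bint by (intro nn_integral_eq_integral) auto
    also have "(LINT x|M. 2 ^ k * (norm (d k x))\<^sup>2 + (1/2) ^ k)
        = 2 ^ k * (LINT x|M. (norm (d k x))\<^sup>2) + (1/2) ^ k * m"
      using dint by (simp add: d_def m_def)
    also have "ennreal \<dots> \<le> ennreal (2 ^ k * (1/4) ^ k + (1/2) ^ k * m)"
      using cauchy[of k "Suc k"] by (intro ennreal_leI add_right_mono mult_left_mono) (auto simp: d_def)
    also have "(2::real) ^ k * (1/4) ^ k = (1/2) ^ k"
      by (simp flip: power_mult_distrib)
    finally show ?thesis by (simp add: algebra_simps)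
  qed
  have dm[measurable]: "d k \<in> borel_measurable M" for k
    unfolding d_def by measurable
  \<comment> \<open>The sum of the increments has finite integral, hence is finite almost
    everywhere, so the telescoping series converges absolutely there.\<close>
  have "(\<integral>\<^sup>+x. (\<Sum>k. ennreal (norm (d k x))) \<partial>M) = (\<Sum>k. \<integral>\<^sup>+x. ennreal (norm (d k x)) \<partial>M)"
    by (rule nn_integral_suminf) measurable
  also have "\<dots> \<le> (\<Sum>k. ennreal ((1/2) ^ k * (1 + m)))"
    by (intro suminf_le nint) auto
  also have "\<dots> < \<infinity>"
  proof -
    have "summable (\<lambda>k. (1/2) ^ k * (1 + m) :: real)"
      by (intro summable_mult2 summable_geometric) auto
    then show ?thesis
      by (subst suminf_ennreal2) (auto simp: m_def)
  qed
  finally have "AE x in M. (\<Sum>k. ennreal (norm (d k x))) \<noteq> \<infinity>"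
    by (intro nn_integral_PInf_AE) auto
  then have conv: "AE x in M. convergent (\<lambda>k. v k x)"
  proof eventually_elim
    case (elim x)
    then have "summable (\<lambda>k. norm (d k x))"
      by (intro summable_suminf_not_top) auto
    then have "summable (\<lambda>k. d k x)" by (rule summable_norm_cancel)
    then have "convergent (\<lambda>n. \<Sum>k<n. d k x)" by (simp add: summable_iff_convergent)
    moreover have "(\<Sum>k<n. d k x) = v n x - v 0 x" for n
      unfolding d_def by (rule sum_lessThan_telescope)
    ultimately have "convergent (\<lambda>n. v n x - v 0 x + v 0 x)"
      by (intro convergent_add convergent_const) auto
    then show ?case by simp
  qed
  \<comment> \<open>Where the sequence diverges, \<open>lim\<close> has an unspecified value; by
    \<open>conv\<close> this affects a null set only.\<close>
  define u where "u x = lim (\<lambda>k. v k x)" for x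
  have um[measurable]: "u \<in> borel_measurable M" unfolding u_def by measurable
  \<comment> \<open>Fatou's lemma in \<open>j\<close> for fixed \<open>k\<close>.\<close>
  have nn: "(\<integral>\<^sup>+x. ennreal ((norm (v k x - u x))\<^sup>2) \<partial>M) \<le> ennreal ((1/4) ^ k)" for k
  proof -
    have "AE x in M. ennreal ((norm (v k x - u x))\<^sup>2)
        = liminf (\<lambda>j. ennreal ((norm (v j x - v k x))\<^sup>2))"
      using conv
    proof eventually_elim
      case (elim x)
      then have "(\<lambda>j. v j x) \<longlonglongrightarrow> u x" by (simp add: u_def convergent_LIMSEQ_iff)
      then have "(\<lambda>j. ennreal ((norm (v j x - v k x))\<^sup>2)) \<longlonglongrightarrow> ennreal ((norm (u x - v k x))\<^sup>2)"
        by (intro tendsto_intros tendsto_ennrealI)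
      then have "liminf (\<lambda>j. ennreal ((norm (v j x - v k x))\<^sup>2)) = ennreal ((norm (u x - v k x))\<^sup>2)"
        by (intro lim_imp_Liminf) auto
      then show ?case by (simp add: norm_minus_commute)
    qed
    then have "(\<integral>\<^sup>+x. ennreal ((norm (v k x - u x))\<^sup>2) \<partial>M)
        = (\<integral>\<^sup>+x. liminf (\<lambda>j. ennreal ((norm (v j x - v k x))\<^sup>2)) \<partial>M)"
      by (rule nn_integral_cong_AE)
    also have "\<dots> \<le> liminf (\<lambda>j. \<integral>\<^sup>+x. ennreal ((norm (v j x - v k x))\<^sup>2) \<partial>M)"
      by (rule nn_integral_liminf) measurable
    also have "\<dots> = liminf (\<lambda>j. ennreal (LINT x|M. (norm (v j x - v k x))\<^sup>2))"
      using dint by (subst nn_integral_eq_integral) auto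
    also have "\<dots> \<le> limsup (\<lambda>j. ennreal (LINT x|M. (norm (v j x - v k x))\<^sup>2))"
      by (rule Liminf_le_Limsup) simp
    also have "\<dots> \<le> ennreal ((1/4) ^ k)"
      by (intro Limsup_bounded eventually_sequentiallyI[of k] ennreal_leI cauchy)
    finally show ?thesis .
  qed
  have uint: "integrable M (\<lambda>x. (norm (v k x - u x))\<^sup>2)" for k
    using nn[of k] by (intro integrableI_bounded) (auto simp: ennreal_less_top le_less_trans)
  \<comment> \<open>Membership of \<open>u\<close> follows by writing it as \<open>v 0\<close> minus
    this difference.\<close>
  have "square_integrable M (\<lambda>x. v 0 x - u x)"
    using uint by (simp add: square_integrable_def)
  from square_integrable_diff[OF v[of 0] this] have u: "square_integrable M u" by simp
  have bound: "(LINT x|M. (norm (v k x - u x))\<^sup>2) \<le> (1/4) ^ k" for k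
    using nn[of k] uint[of k] by (simp add: nn_integral_eq_integral)
  have "(\<lambda>k. LINT x|M. (norm (v k x - u x))\<^sup>2) \<longlonglongrightarrow> 0"
    by (rule tendsto_sandwich[of "\<lambda>_. 0" _ _ "\<lambda>k. (1/4) ^ k"])
      (auto intro!: always_eventually bound LIMSEQ_power_zero)
  with u show ?thesis by (rule that)
qed

text \<open>The Riesz representation theorem on the closure of the range of \<open>P\<close>: the representing
  function is the limit of a minimizing sequence of \<open>\<parallel>P \<alpha>\<parallel>\<^sup>2 / 2 - l \<alpha>\<close>.\<close>

lemma L2_representation:
  fixes T :: "('x \<Rightarrow> 'c::real_vector) set" and P :: "('x \<Rightarrow> 'c) \<Rightarrow> 'a \<Rightarrow> 'b::euclidean_space"
  assumes M: "finite_measure M" and ne: "T \<noteq> {}"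
    and T: "\<And>a b t. a \<in> T \<Longrightarrow> b \<in> T \<Longrightarrow> (\<lambda>x. a x + t *\<^sub>R b x) \<in> T"
    and P: "\<And>a b t y. a \<in> T \<Longrightarrow> b \<in> T \<Longrightarrow> P (\<lambda>x. a x + t *\<^sub>R b x) y = P a y + t *\<^sub>R P b y"
    and sq: "\<And>a. a \<in> T \<Longrightarrow> square_integrable M (P a)"
    and l: "\<And>a b t. a \<in> T \<Longrightarrow> b \<in> T \<Longrightarrow> l (\<lambda>x. a x + t *\<^sub>R b x) = l a + t * l b"
    and bdd: "\<And>a. a \<in> T \<Longrightarrow> l a \<le> C + (LINT x|M. (norm (P a x))\<^sup>2) / 2"
  obtains u where "square_integrable M u" "\<And>a. a \<in> T \<Longrightarrow> (LINT x|M. u x \<bullet> P a x) = l a"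
proof -
  define Q where "Q a = (LINT x|M. (norm (P a x))\<^sup>2)" for a
  define J where "J a = Q a / 2 - l a" for a
  define m where "m = Inf (J ` T)"
  have bb: "bdd_below (J ` T)"
    using bdd by (intro bdd_belowI2[of _ "- C"]) (force simp: J_def Q_def)
  have m: "m \<le> J a" if "a \<in> T" for a
    unfolding m_def using that bb by (intro cInf_lower) auto
  \<comment> \<open>The tolerance is fixed so that \<open>diff\<close> yields exactly the rate
    \<open>(1/4) ^ k\<close> required by \<open>L2_complete\<close>.\<close>
  have "\<exists>a\<in>T. J a \<le> m + (1/4) ^ k / 8" for k :: nat
  proof -
    have "Inf (J ` T) < m + (1/4) ^ k / 8" by (simp add: m_def)
    then show ?thesis
      using cInf_less_iff[OF _ bb] ne by (auto intro: less_imp_le)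
  qed
  then obtain a where aT: "\<And>k. a k \<in> T" and aJ: "\<And>k. J (a k) \<le> m + (1/4) ^ k / 8"
    by metis
  \<comment> \<open>The slope at \<open>t = 0\<close> is the defect of \<open>P b\<close> in
    representing \<open>l c\<close>; it must tend to zero along a minimizing sequence.\<close>
  have J_affine: "J (\<lambda>x. b x + t *\<^sub>R c x)
      = J b + t * ((LINT x|M. P b x \<bullet> P c x) - l c) + t\<^sup>2 * Q c / 2" if "b \<in> T" "c \<in> T" for b c t
    using integral_norm_sq_affine[OF sq sq, OF that, of t]
    by (simp add: J_def Q_def P[OF that] l[OF that] algebra_simps add_divide_distrib)
  \<comment> \<open>The parallelogram identity: \<open>J\<close> at the midpoint of \<open>b\<close>
    and \<open>c\<close> is at least \<open>m\<close>, so near-minimizers have nearby images under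
    \<open>P\<close>.\<close>
  have diff: "(LINT x|M. (norm (P b x - P c x))\<^sup>2) \<le> 4 * (J b + J c - 2 * m)" if bc: "b \<in> T" "c \<in> T" for b c
  proof -
    have d: "(\<lambda>x. b x + (-1) *\<^sub>R c x) \<in> T" by (intro T bc)
    have mid: "(\<lambda>x. c x + (1/2) *\<^sub>R (b x + (-1) *\<^sub>R c x)) \<in> T" using T[OF bc(2) d] .
    have Qd: "Q (\<lambda>x. b x + (-1) *\<^sub>R c x) = (LINT x|M. (norm (P b x - P c x))\<^sup>2)"
      by (simp only: Q_def P[OF bc]) simp
    have Jb: "J b = J (\<lambda>x. c x + 1 *\<^sub>R (b x + (-1) *\<^sub>R c x))" by simp
    have "J b + J c - 2 * J (\<lambda>x. c x + (1/2) *\<^sub>R (b x + (-1) *\<^sub>R c x))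
        = Q (\<lambda>x. b x + (-1) *\<^sub>R c x) / 4"
      unfolding Jb J_affine[OF bc(2) d] by (simp add: power2_eq_square algebra_simps)
    with m[OF mid] Qd show ?thesis by simp
  qed
  have "(LINT x|M. (norm (P (a j) x - P (a k) x))\<^sup>2) \<le> (1/4) ^ k" if "k \<le> j" for j k
  proof -
    have "(1/4::real) ^ j \<le> (1/4) ^ k" using that by (intro power_decreasing) auto
    \<comment> \<open>Here \<open>p\<close> and \<open>q\<close> stand for the tolerances at
      \<open>j\<close> and \<open>k\<close>: four times the sum of \<open>p / 8\<close> and
      \<open>q / 8\<close> is at most \<open>q\<close>.\<close>
    moreover have "X \<le> q" if "p \<le> q" "X \<le> 4 * (y + z - 2 * m)" "y \<le> m + p / 8" "z \<le> m + q / 8"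
      for X y z p q :: real
      using that by argo
    ultimately show ?thesis using diff[OF aT aT] aJ by blast
  qed
  \<comment> \<open>The images \<open>P (a k)\<close> converge, although the \<open>a k\<close>
    themselves may not. The limit lies in the closure of the range of \<open>P\<close>.\<close>
  from L2_complete[OF M sq[OF aT] this]
  obtain u where u: "square_integrable M u"
    and lim: "(\<lambda>k. LINT x|M. (norm (P (a k) x - u x))\<^sup>2) \<longlonglongrightarrow> 0"
    by blast
  have "(LINT x|M. u x \<bullet> P b x) = l b" if b: "b \<in> T" for b
  proof -
    define D where "D = (LINT x|M. u x \<bullet> P b x) - l b"
    \<comment> \<open>The minimality of \<open>m\<close>, up to the tolerance of \<open>a k\<close>,
      passed to the limit. Since \<open>t\<close> has either sign, the linear coefficient
      \<open>D\<close> must vanish.\<close>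
    have nonneg: "0 \<le> t * D + t\<^sup>2 * Q b / 2" for t
    proof (rule tendsto_le[OF sequentially_bot])
      show "(\<lambda>k. t * ((LINT x|M. P (a k) x \<bullet> P b x) - l b) + t\<^sup>2 * Q b / 2)
          \<longlonglongrightarrow> t * D + t\<^sup>2 * Q b / 2"
        unfolding D_def
        by (intro tendsto_intros integral_inner_tendsto[OF sq[OF aT] u lim sq[OF b]])
      show "(\<lambda>k. - ((1/4::real) ^ k / 8)) \<longlonglongrightarrow> 0"
        using tendsto_minus[OF tendsto_divide_0[OF LIMSEQ_power_zero[of "1/4::real"]]]
        by (auto intro!: tendsto_eq_intros LIMSEQ_power_zero)
      show "\<forall>\<^sub>F k in sequentially. - ((1/4) ^ k / 8)
          \<le> t * ((LINT x|M. P (a k) x \<bullet> P b x) - l b) + t\<^sup>2 * Q b / 2"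
      proof (intro always_eventually allI)
        fix k
        show "- ((1/4) ^ k / 8) \<le> t * ((LINT x|M. P (a k) x \<bullet> P b x) - l b) + t\<^sup>2 * Q b / 2"
          using m[OF T[OF aT b, of k t]] aJ[of k] unfolding J_affine[OF aT b] by linarith
      qed
    qed
    \<comment> \<open>For this \<open>t\<close> the quadratic equals
      \<open>- t\<^sup>2 * (Q b / 2 + 1)\<close>, which is nonnegative only for
      \<open>t = 0\<close>.\<close>
    define t where "t = - D / (Q b + 1)"
    have Q: "Q b \<ge> 0" by (simp add: Q_def)
    then have D: "D = - t * (Q b + 1)" by (simp add: t_def)
    have "t\<^sup>2 * (Q b / 2 + 1) \<le> 0"
      using nonneg[of t] unfolding D by (simp add: power2_eq_square algebra_simps)
    then have "t = 0" using Q by (simp add: mult_le_0_iff)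
    then show ?thesis using D by (simp add: D_def)
  qed
  with u show ?thesis by (rule that)
qed

section \<open>Test functions and the Clifford product\<close>

lemma partial_deriv_eqI:
  assumes "directional_deriv (axis i 1) h h'"
  shows "partial_deriv i h = h'"
  using assms unfolding directional_deriv_def partial_deriv_def
  by (auto simp: fun_eq_iff intro: DERIV_imp_deriv)

text \<open>\<open>deriv\<close> is meaningful only where a derivative exists; the chain rule along
  the coordinate line provides it.\<close>

lemma differentiable_directional_deriv:
  assumes "\<And>x. h differentiable (at x)"
  shows "directional_deriv (axis i 1) h (partial_deriv i h)"
  unfolding directional_deriv_def partial_deriv_def
proof
  fix x
  have "(\<lambda>t. h (x + t *\<^sub>R axis i 1)) differentiable (at (0::real))"
    using assms[of "x + 0 *\<^sub>R axis i 1"]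
    by (intro differentiable_compose[of h "\<lambda>t. x + t *\<^sub>R axis i 1"] derivative_intros) auto
  then show "((\<lambda>t. h (x + t *\<^sub>R axis i 1)) has_real_derivative
      deriv (\<lambda>t. h (x + t *\<^sub>R axis i 1)) 0) (at 0)"
    by (metis DERIV_imp_deriv real_differentiableE)
qed

section \<open>Linear combinations of smooth functions\<close>

lemma directional_deriv_affine:
  "directional_deriv v a a' \<Longrightarrow> directional_deriv v b b' \<Longrightarrow>
    directional_deriv v (\<lambda>x. a x + t * b x) (\<lambda>x. a' x + t * b' x)"
  unfolding directional_deriv_def by (auto intro!: derivative_eq_intros)

lemma C_k_zero: "C_k k (\<lambda>x::real^'i::finite. 0)"
  by (induction k) (auto simp: partial_deriv_def[abs_def])

lemma C_k_affine: "C_k k a \<Longrightarrow> C_k k b \<Longrightarrow> C_k k (\<lambda>x. a x + t * b x)"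
proof (induction k arbitrary: a b)
  case 0
  then show ?case by (auto intro!: continuous_intros)
next
  case (Suc k)
  have "partial_deriv i (\<lambda>x. a x + t * b x) = (\<lambda>x. partial_deriv i a x + t * partial_deriv i b x)" for i
    using Suc.prems
    by (intro partial_deriv_eqI directional_deriv_affine differentiable_directional_deriv) auto
  with Suc show ?case by (auto intro!: derivative_intros)
qed

lemma smooth_affine: "smooth a \<Longrightarrow> smooth b \<Longrightarrow> smooth (\<lambda>x. a x + t * b x)"
  by (simp add: smooth_def C_k_affine)

lemma smooth_sum:
  assumes "finite S" "\<And>s. s \<in> S \<Longrightarrow> smooth (a s)"
  shows "smooth (\<lambda>x. \<Sum>s\<in>S. a s x * t s)"
  using assms
proof (induction S rule: finite_induct)
  case empty
  then show ?case by (simp add: smooth_def C_k_zero)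
next
  case (insert s S)
  then have "smooth (\<lambda>x. (\<Sum>s\<in>S. a s x * t s) + t s * a s x)"
    by (intro smooth_affine) auto
  with insert show ?case by (simp add: algebra_simps)
qed

lemma smooth_differentiable: "smooth h \<Longrightarrow> h differentiable (at x)"
  unfolding smooth_def by (metis C_k.simps(2))

lemma smooth_continuous: "smooth h \<Longrightarrow> continuous_on UNIV h"
  unfolding smooth_def by (metis C_k.simps(1))

lemma smooth_partial_continuous: "smooth h \<Longrightarrow> continuous_on UNIV (partial_deriv i h)"
  unfolding smooth_def by (metis C_k.simps)

lemma smooth_directional_deriv: "smooth h \<Longrightarrow> directional_deriv (axis i 1) h (partial_deriv i h)"
  by (intro differentiable_directional_deriv smooth_differentiable)

text \<open>The definition speaks of closures of the supports of the components. One compact set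
  carrying all components is easier to combine; \<open>test_functions_support\<close> is the
  converse passage.\<close>

lemma test_functionsI:
  assumes "\<And>A. smooth (\<lambda>x. \<alpha> x $ A)" "compact K" "K \<subseteq> \<Omega>" "\<And>x. x \<notin> K \<Longrightarrow> \<alpha> x = 0"
  shows "\<alpha> \<in> test_functions \<Omega>"
proof -
  have *: "closure {x. \<alpha> x $ A \<noteq> 0} \<subseteq> K" for A
    using assms(4) by (intro closure_minimal compact_imp_closed assms(2)) force
  then have "compact (closure {x. \<alpha> x $ A \<noteq> 0})" for A
    using compact_Int_closed[OF assms(2) closed_closure] by (metis inf.absorb2)
  with * assms show ?thesis by (fastforce simp: test_functions_def)
qed

lemma test_functions_smooth: "\<alpha> \<in> test_functions \<Omega> \<Longrightarrow> smooth (\<lambda>x. \<alpha> x $ A)"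
  by (simp add: test_functions_def)

lemma test_functions_support:
  assumes "\<alpha> \<in> test_functions \<Omega>"
  obtains K where "compact K" "K \<subseteq> \<Omega>" "\<And>x. x \<notin> K \<Longrightarrow> \<alpha> x = 0"
proof (rule that)
  let ?K = "\<Union>A. closure {x. \<alpha> x $ A \<noteq> 0}"
  show "compact ?K" "?K \<subseteq> \<Omega>"
    using assms by (auto simp: test_functions_def)
  show "\<alpha> x = 0" if "x \<notin> ?K" for x
  proof (rule vec_eq_iff[THEN iffD2], rule allI)
    fix A
    have "x \<notin> {x. \<alpha> x $ A \<noteq> 0}"
      using that closure_subset[of "{x. \<alpha> x $ A \<noteq> 0}"] by blast
    then show "\<alpha> x $ A = 0 $ A" by simp
  qed
qed

lemma test_functions_affine:
  assumes "\<alpha> \<in> test_functions \<Omega>" "\<beta> \<in> test_functions \<Omega>"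
  shows "(\<lambda>x. \<alpha> x + t *\<^sub>R \<beta> x) \<in> test_functions \<Omega>"
proof -
  obtain K where K: "compact K" "K \<subseteq> \<Omega>" "\<And>x. x \<notin> K \<Longrightarrow> \<alpha> x = 0"
    using test_functions_support[OF assms(1)] by blast
  obtain L where L: "compact L" "L \<subseteq> \<Omega>" "\<And>x. x \<notin> L \<Longrightarrow> \<beta> x = 0"
    using test_functions_support[OF assms(2)] by blast
  show ?thesis
    using K L assms by (intro test_functionsI[of _ "K \<union> L"])
      (auto intro!: smooth_affine test_functions_smooth)
qed

text \<open>Exhibits left multiplication by a constant as a linear combination of coordinates with
  constant coefficients, to which \<open>smooth_sum\<close> and \<open>directional_deriv_sum\<close>
  apply.\<close>

lemma cl_mult_component: "(z \<odot> y) $ C = (\<Sum>A\<in>UNIV. y $ A * (z \<odot> cl_basis A) $ C)"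
proof -
  have "z \<odot> y = z \<odot> (\<Sum>A\<in>UNIV. (y $ A) *\<^sub>R cl_basis A)"
    by (simp flip: cl_expand)
  then show ?thesis by (simp add: cl_mult.sum_right cl_mult.scaleR_right)
qed

lemma test_functions_mult:
  assumes "\<alpha> \<in> test_functions \<Omega>"
  shows "(\<lambda>x. z \<odot> \<alpha> x) \<in> test_functions \<Omega>"
proof -
  obtain K where K: "compact K" "K \<subseteq> \<Omega>" "\<And>x. x \<notin> K \<Longrightarrow> \<alpha> x = 0"
    using test_functions_support[OF assms] by blast
  define c where "c A C = (z \<odot> cl_basis A) $ C" for A C
  have c: "(z \<odot> y) $ C = (\<Sum>A\<in>UNIV. y $ A * c A C)" for y C
    unfolding c_def by (rule cl_mult_component)
  show ?thesis
    using K assms by (intro test_functionsI[of _ K])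
      (auto simp: cl_mult.zero_right c intro!: smooth_sum test_functions_smooth)
qed

text \<open>Collecting the derivatives of all components in one vector lets the operator be written
  with Clifford products only, as in \<open>Dbar_right_eq\<close>.\<close>

definition cl_partial ::
    "'n option \<Rightarrow> (real ^ ('n option) \<Rightarrow> 'n::{finite,linorder} clifford) \<Rightarrow> real ^ ('n option) \<Rightarrow> 'n clifford" where
  "cl_partial i g x = (\<chi> A. partial_deriv i (\<lambda>y. g y $ A) x)"

lemma Dbar_right_eq: "Dbar_right g x = (\<Sum>i\<in>UNIV. cl_partial i g x \<odot> cl_gen i)"
proof -
  have "cl_partial i g x \<odot> cl_gen i
      = (\<Sum>A\<in>UNIV. partial_deriv i (\<lambda>y. g y $ A) x *\<^sub>R (cl_basis A \<odot> cl_gen i))" for i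
    by (subst cl_expand[of "cl_partial i g x"])
      (simp add: cl_mult.sum_left cl_mult.scaleR_left cl_partial_def)
  then show ?thesis by (simp add: Dbar_right_def)
qed

lemma cl_partial_affine:
  assumes "\<alpha> \<in> test_functions \<Omega>" "\<beta> \<in> test_functions \<Omega>"
  shows "cl_partial i (\<lambda>x. \<alpha> x + t *\<^sub>R \<beta> x) x = cl_partial i \<alpha> x + t *\<^sub>R cl_partial i \<beta> x"
proof -
  have "partial_deriv i (\<lambda>x. \<alpha> x $ A + t * \<beta> x $ A)
      = (\<lambda>x. partial_deriv i (\<lambda>x. \<alpha> x $ A) x + t * partial_deriv i (\<lambda>x. \<beta> x $ A) x)" for A
    using assms
    by (intro partial_deriv_eqI directional_deriv_affine smooth_directional_deriv test_functions_smooth)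
  then show ?thesis by (simp add: cl_partial_def vec_eq_iff)
qed

lemma directional_deriv_sum:
  assumes "\<And>s. s \<in> S \<Longrightarrow> directional_deriv v (a s) (a' s)"
  shows "directional_deriv v (\<lambda>x. \<Sum>s\<in>S. a s x * t s) (\<lambda>x. \<Sum>s\<in>S. a' s x * t s)"
  using assms unfolding directional_deriv_def
  by (auto intro!: DERIV_sum DERIV_cmult_right)

lemma cl_partial_mult:
  assumes "\<alpha> \<in> test_functions \<Omega>"
  shows "cl_partial i (\<lambda>x. z \<odot> \<alpha> x) x = z \<odot> cl_partial i \<alpha> x"
proof -
  define c where "c A C = (z \<odot> cl_basis A) $ C" for A C
  have c: "(z \<odot> y) $ C = (\<Sum>A\<in>UNIV. y $ A * c A C)" for y C
    unfolding c_def by (rule cl_mult_component)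
  have "partial_deriv i (\<lambda>x. \<Sum>A\<in>UNIV. \<alpha> x $ A * c A C)
      = (\<lambda>x. \<Sum>A\<in>UNIV. partial_deriv i (\<lambda>x. \<alpha> x $ A) x * c A C)" for C
    using assms
    by (intro partial_deriv_eqI directional_deriv_sum smooth_directional_deriv test_functions_smooth)
  then show ?thesis by (simp add: cl_partial_def vec_eq_iff c)
qed

lemma Dbar_right_affine:
  assumes "\<alpha> \<in> test_functions \<Omega>" "\<beta> \<in> test_functions \<Omega>"
  shows "Dbar_right (\<lambda>x. \<alpha> x + t *\<^sub>R \<beta> x) x = Dbar_right \<alpha> x + t *\<^sub>R Dbar_right \<beta> x"
  by (simp add: Dbar_right_eq cl_partial_affine[OF assms] cl_mult.add_left cl_mult.scaleR_left
      sum.distrib scaleR_sum_right)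

text \<open>The constant multiplies from the left and the generators from the right, so
  associativity lets the operator pass it.\<close>

lemma Dbar_right_mult:
  "\<alpha> \<in> test_functions \<Omega> \<Longrightarrow> Dbar_right (\<lambda>x. z \<odot> \<alpha> x) x = z \<odot> Dbar_right \<alpha> x"
  by (simp add: Dbar_right_eq cl_partial_mult cl_mult_assoc cl_mult.sum_right)

text \<open>Symmetric difference with \<open>D\<close> is an involution, so right multiplication by
  a basis element permutes the coordinates up to sign and a single summand survives.\<close>

lemma cl_mult_basis_component:
  "(x \<odot> cl_basis D) $ B = x $ sym_diff B D * cl_sign (sym_diff B D) D"
proof -
  have "(x \<odot> cl_basis D) $ B = ((\<Sum>A\<in>UNIV. (x $ A) *\<^sub>R cl_basis A) \<odot> cl_basis D) $ B"
    by (simp flip: cl_expand)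
  also have "\<dots> = (\<Sum>A\<in>UNIV. x $ A * (cl_sign A D * cl_basis (sym_diff A D) $ B))"
    by (simp add: cl_mult.sum_left cl_mult.scaleR_left cl_mult_basis mult.assoc)
  also have "\<dots> = (\<Sum>A\<in>UNIV. if A = sym_diff B D then x $ A * cl_sign A D else 0)"
  proof (rule sum.cong)
    fix A
    have "cl_basis (sym_diff A D) $ B = (if A = sym_diff B D then 1 else 0)"
    proof -
      have "B = sym_diff A D \<longleftrightarrow> A = sym_diff B D" by blast
      then show ?thesis by (simp only: cl_basis_def axis_def vec_lambda_beta)
    qed
    then show "x $ A * (cl_sign A D * cl_basis (sym_diff A D) $ B)
        = (if A = sym_diff B D then x $ A * cl_sign A D else 0)"
      by simp
  qed simp
  finally show ?thesis by (simp only: sum.delta finite if_True UNIV_I)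
qed

section \<open>Skewness of right multiplication by the generators\<close>

lemma cl_sign_singleton: "cl_sign {j} {j} = -1"
  by (simp add: cl_sign_prod)

lemma inner_cl_mult_gen:
  "x \<bullet> (y \<odot> cl_gen (Some j)) = (\<Sum>B\<in>UNIV. x $ B * y $ sym_diff B {j} * - cl_sign B {j})"
  by (simp add: inner_vec_def cl_gen_def cl_mult_basis_component cl_sign_sym_diff_left
      cl_sign_singleton mult.assoc)

text \<open>Reindexing by the involution \<open>\<lambda>B. sym_diff B {j}\<close> exchanges the
  coordinates of \<open>x\<close> and \<open>y\<close>, and the sign flips because the generator
  squares to -1.\<close>

lemma cl_mult_gen_skew: "x \<bullet> (y \<odot> cl_gen (Some j)) = - (y \<bullet> (x \<odot> cl_gen (Some j)))"
proof -
  have bij: "bij (\<lambda>B. sym_diff B {j})"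
    by (rule o_bij[where g="\<lambda>B. sym_diff B {j}"]) (auto simp: fun_eq_iff)
  have "x \<bullet> (y \<odot> cl_gen (Some j))
      = (\<Sum>B\<in>UNIV. x $ sym_diff B {j} * y $ sym_diff (sym_diff B {j}) {j} * - cl_sign (sym_diff B {j}) {j})"
    unfolding inner_cl_mult_gen by (rule sum.reindex_bij_betw[OF bij, symmetric])
  also have "\<dots> = (\<Sum>B\<in>UNIV. - (y $ B * x $ sym_diff B {j} * - cl_sign B {j}))"
  proof (rule sum.cong)
    fix B
    have "sym_diff (sym_diff B {j}) {j} = B" by blast
    then show "x $ sym_diff B {j} * y $ sym_diff (sym_diff B {j}) {j} * - cl_sign (sym_diff B {j}) {j}
      = - (y $ B * x $ sym_diff B {j} * - cl_sign B {j})"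
      by (simp add: cl_sign_sym_diff_left cl_sign_singleton)
  qed simp
  finally show ?thesis by (simp add: inner_cl_mult_gen sum_negf)
qed

section \<open>Clifford conjugation and the scalar part of a product\<close>

lemma cl_sign_self_square: "cl_sign A A * cl_sign A A = 1"
  by (simp add: cl_sign_def flip: power_add mult_2)

text \<open>This is Clifford conjugation: for \<open>r = card A\<close> there are
  \<open>r * (r + 1) / 2\<close> pairs with \<open>b \<le> a\<close> in \<open>A \<times> A\<close>,
  which gives the usual sign.\<close>

definition cl_twist :: "'n::{finite,linorder} clifford \<Rightarrow> 'n clifford" where
  "cl_twist y = (\<chi> A. cl_sign A A * y $ A)"

lemma cl_twist_twist: "cl_twist (cl_twist y) = y"
  by (simp add: cl_twist_def vec_eq_iff cl_sign_self_square flip: mult.assoc)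

lemma norm_cl_twist: "norm (cl_twist y) = norm y"
proof -
  have "cl_sign A A * y $ A * (cl_sign A A * y $ A) = y $ A * y $ A" for A
    by (simp only: cl_sign_self_square mult_1_left
        mult.assoc[symmetric] mult.commute[of "cl_sign A A * y $ A" "cl_sign A A"])
  then show ?thesis by (simp only: norm_eq inner_vec_def cl_twist_def vec_lambda_beta inner_real_def)
qed

lemma linear_cl_twist: "linear cl_twist"
  by (intro linearI) (auto simp: cl_twist_def vec_eq_iff algebra_simps)

text \<open>Only equal indices contribute to the empty set. This turns the Clifford pairing of the
  weak formulation into the Euclidean inner product, where \<open>L2_representation\<close>
  applies.\<close>

lemma cl_mult_scalar_part: "(x \<odot> y) $ {} = x \<bullet> cl_twist y"
proof -
  have "(x \<odot> y) $ {} = (\<Sum>B\<in>UNIV. y $ B * (x \<odot> cl_basis B) $ {})"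
    by (rule cl_mult_component)
  also have "\<dots> = (\<Sum>B\<in>UNIV. x $ B * (cl_sign B B * y $ B))"
    by (simp add: cl_mult_basis_component mult_ac)
  finally show ?thesis by (simp add: inner_vec_def cl_twist_def)
qed

text \<open>Left multiplication by a basis element moves its coordinate to the scalar part, up to a
  sign that is its own inverse.\<close>

lemma cl_component_eq: "y $ C = cl_sign C C * (cl_basis C \<odot> y) $ {}"
proof -
  have "(cl_basis C \<odot> y) $ {} = cl_sign C C * y $ C"
    by (simp add: cl_mult_scalar_part cl_basis_def inner_axis' cl_twist_def)
  then show ?thesis by (simp add: cl_sign_self_square flip: mult.assoc)
qed

lemma cl_mult_component_twist:
  "(x \<odot> y) $ C = cl_sign C C * ((cl_basis C \<odot> x) \<bullet> cl_twist y)"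
  by (subst cl_component_eq) (simp add: cl_mult_scalar_part flip: cl_mult_assoc)

section \<open>Compactly supported vector-valued functions\<close>

lemma compactly_supported_vec:
  fixes F :: "'a::metric_space \<Rightarrow> real ^ 'k::finite"
  assumes "\<And>A. compactly_supported (\<lambda>x. F x $ A)"
  shows "compactly_supported F"
proof -
  have "\<forall>A. \<exists>K. compact K \<and> (\<forall>x. x \<notin> K \<longrightarrow> F x $ A = 0)"
    using assms by (auto simp: compactly_supported_def)
  then obtain K where K: "\<And>A. compact (K A)" "\<And>A x. x \<notin> K A \<Longrightarrow> F x $ A = 0"
    by metis
  have "continuous_on UNIV (\<lambda>x. \<chi> A. F x $ A)"
    using assms by (intro continuous_on_vec_lambda compactly_supported_continuous)
  then show ?thesis
    using K by (intro compactly_supportedI[of _ "\<Union>A. K A"]) (auto simp: vec_eq_iff)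
qed

lemma compactly_supported_component:
  fixes F :: "'a::metric_space \<Rightarrow> real ^ 'k::finite"
  shows "compactly_supported F \<Longrightarrow> compactly_supported (\<lambda>x. F x $ A)"
  by (auto simp: compactly_supported_def intro!: continuous_intros)

lemma compactly_supported_inner:
  fixes F G :: "'a::metric_space \<Rightarrow> 'b::real_inner"
  assumes "compactly_supported F" "compactly_supported G"
  shows "compactly_supported (\<lambda>x. F x \<bullet> G x)"
  using assms by (fastforce simp: compactly_supported_def intro!: continuous_intros)

lemma compactly_supported_bounded_linear:
  assumes "compactly_supported F" "bounded_linear L"
  shows "compactly_supported (\<lambda>x. L (F x))"
proof -
  obtain K where "compact K" "\<And>x. x \<notin> K \<Longrightarrow> F x = 0"
    using assms(1) by (auto simp: compactly_supported_def)
  then show ?thesis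
    using linear_0[OF bounded_linear.linear[OF assms(2)]]
      bounded_linear.continuous_on[OF assms(2) compactly_supported_continuous[OF assms(1)]]
    by (intro compactly_supportedI[of _ K]) auto
qed

lemma compactly_supported_sum:
  assumes "finite I" "\<And>i. i \<in> I \<Longrightarrow> compactly_supported (F i)"
  shows "compactly_supported (\<lambda>x. \<Sum>i\<in>I. F i x)"
  using assms
proof (induction I rule: finite_induct)
  case empty
  show ?case by (intro compactly_supportedI[of _ "{}"]) auto
next
  case (insert i I)
  have "compactly_supported (F i)" "compactly_supported (\<lambda>x. \<Sum>i\<in>I. F i x)"
    using insert by auto
  then obtain K L where K: "compact K" "\<And>x. x \<notin> K \<Longrightarrow> F i x = 0" "continuous_on UNIV (F i)"
    and L: "compact L" "\<And>x. x \<notin> L \<Longrightarrow> (\<Sum>i\<in>I. F i x) = 0"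
      "continuous_on UNIV (\<lambda>x. \<Sum>i\<in>I. F i x)"
    unfolding compactly_supported_def by blast
  show ?case
    using insert K L by (intro compactly_supportedI[of _ "K \<union> L"]) (auto intro!: continuous_intros)
qed

lemma test_functions_compactly_supported:
  assumes "\<alpha> \<in> test_functions \<Omega>"
  shows "compactly_supported \<alpha>"
proof -
  obtain K where "compact K" "K \<subseteq> \<Omega>" "\<And>x. x \<notin> K \<Longrightarrow> \<alpha> x = 0"
    using test_functions_support[OF assms] by blast
  then show ?thesis
    by (intro compactly_supported_vec compactly_supportedI[of _ K] smooth_continuous
        test_functions_smooth[OF assms]) simp_all
qed

lemma test_functions_zero_outside:
  assumes "\<alpha> \<in> test_functions \<Omega>" "x \<notin> \<Omega>"
  shows "\<alpha> x = 0"
proof -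
  obtain K where "compact K" "K \<subseteq> \<Omega>" "\<And>x. x \<notin> K \<Longrightarrow> \<alpha> x = 0"
    using test_functions_support[OF assms(1)] by blast
  with assms(2) show ?thesis by blast
qed

section \<open>The a priori estimate\<close>

lemma cl_partial_directional_deriv:
  "\<alpha> \<in> test_functions \<Omega> \<Longrightarrow>
    directional_deriv (axis i 1) (\<lambda>x. \<alpha> x $ A) (\<lambda>x. cl_partial i \<alpha> x $ A)"
  using smooth_directional_deriv[OF test_functions_smooth] by (fastforce simp: cl_partial_def)

lemma cl_partial_continuous:
  "\<alpha> \<in> test_functions \<Omega> \<Longrightarrow> continuous_on UNIV (\<lambda>x. cl_partial i \<alpha> x $ A)"
  using smooth_partial_continuous[OF test_functions_smooth] by (fastforce simp: cl_partial_def)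

lemma cl_partial_compactly_supported:
  assumes "\<alpha> \<in> test_functions \<Omega>"
  shows "compactly_supported (cl_partial i \<alpha>)"
proof (rule compactly_supported_vec)
  show "compactly_supported (\<lambda>x. cl_partial i \<alpha> x $ A)" for A
    by (rule compactly_supported_directional_deriv[OF
        compactly_supported_component[OF test_functions_compactly_supported]
        cl_partial_directional_deriv cl_partial_continuous]) (rule assms)+
qed

lemma Dbar_right_compactly_supported:
  assumes "\<alpha> \<in> test_functions \<Omega>"
  shows "compactly_supported (Dbar_right \<alpha>)"
  unfolding Dbar_right_eq[abs_def]
  by (intro compactly_supported_sum finite compactly_supported_bounded_linear[OF
      cl_partial_compactly_supported[OF assms]] cl_mult.bounded_linear_left)

text \<open>Exchanging the two derivatives preserves the integral, while skewness of the right
  multiplication changes its sign.\<close>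

lemma integral_cl_partial_orthogonal:
  assumes "\<alpha> \<in> test_functions \<Omega>"
  shows "(LINT x|lborel. cl_partial i \<alpha> x \<bullet> (cl_partial k \<alpha> x \<odot> cl_gen (Some j))) = 0"
proof -
  define X Y where "X = cl_partial i \<alpha>" and "Y = cl_partial k \<alpha>"
  have int: "integrable lborel (\<lambda>x. cl_partial i \<alpha> x $ A * cl_partial k \<alpha> x $ B)" for A B i k
    by (intro compactly_supported_integrable compactly_supported_mult_left
        compactly_supported_component[OF cl_partial_compactly_supported[OF assms]]
        cl_partial_continuous[OF assms])
  have eq: "(LINT x|lborel. cl_partial i \<alpha> x \<bullet> (cl_partial k \<alpha> x \<odot> cl_gen (Some j)))
      = (\<Sum>B\<in>UNIV. (LINT x|lborel. cl_partial i \<alpha> x $ B * cl_partial k \<alpha> x $ sym_diff B {j}) * - cl_sign B {j})"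
    for i k
    unfolding inner_cl_mult_gen using int by (subst Bochner_Integration.integral_sum) auto
  note c = compactly_supported_component[OF test_functions_compactly_supported[OF assms]]
    and d = cl_partial_directional_deriv[OF assms] and cd = cl_partial_continuous[OF assms]
  \<comment> \<open>The swap lemma for two components of \<alpha> in the directions \<open>i\<close>
    and \<open>k\<close>.\<close>
  have "(LINT x|lborel. cl_partial i \<alpha> x $ A * cl_partial k \<alpha> x $ B)
      = (LINT x|lborel. cl_partial k \<alpha> x $ A * cl_partial i \<alpha> x $ B)" for A B
    by (rule integral_directional_deriv_swap[OF c d cd d cd c d cd d cd])
  then have "(LINT x|lborel. X x \<bullet> (Y x \<odot> cl_gen (Some j)))
      = (LINT x|lborel. Y x \<bullet> (X x \<odot> cl_gen (Some j)))"
    by (simp add: X_def Y_def eq)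
  also have "\<dots> = - (LINT x|lborel. X x \<bullet> (Y x \<odot> cl_gen (Some j)))"
    by (subst cl_mult_gen_skew) simp
  finally show ?thesis by (simp add: X_def Y_def)
qed

text \<open>Pairing \<open>Dbar_right \<alpha>\<close> with the derivative in direction
  \<open>None\<close>, whose coefficient is the unit, leaves only the square of that derivative;
  half of it is then absorbed.\<close>

lemma integral_cl_partial_le_Dbar_right:
  assumes "\<alpha> \<in> test_functions \<Omega>"
  shows "(LINT x|lborel. (norm (cl_partial None \<alpha> x))\<^sup>2) \<le> (LINT x|lborel. (norm (Dbar_right \<alpha> x))\<^sup>2)"
proof -
  define X P where "X = cl_partial None \<alpha>" and "P = Dbar_right \<alpha>"
  note cp = cl_partial_compactly_supported[OF assms]
  have Xc: "compactly_supported X" and Pc: "compactly_supported P"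
    unfolding X_def P_def using Dbar_right_compactly_supported[OF assms] cp by auto
  have split: "X x \<bullet> P x = (norm (X x))\<^sup>2 + (\<Sum>j\<in>UNIV. X x \<bullet> (cl_partial (Some j) \<alpha> x \<odot> cl_gen (Some j)))" for x
    unfolding P_def Dbar_right_eq UNIV_option_conv
    by (simp add: sum.reindex cl_mult_1_right inner_add_right inner_sum_right power2_norm_eq_inner
        flip: X_def)
  have int: "integrable lborel (\<lambda>x. (norm (X x))\<^sup>2)" "integrable lborel (\<lambda>x. (norm (P x))\<^sup>2)"
     "integrable lborel (\<lambda>x. X x \<bullet> P x)"
     "integrable lborel (\<lambda>x. X x \<bullet> (cl_partial (Some j) \<alpha> x \<odot> cl_gen (Some j)))" for j
    unfolding power2_norm_eq_inner using Xc Pc cp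
    by (auto intro!: compactly_supported_integrable compactly_supported_inner
        compactly_supported_bounded_linear[OF _ cl_mult.bounded_linear_left])
  have "(LINT x|lborel. X x \<bullet> P x) = (LINT x|lborel. (norm (X x))\<^sup>2)"
    unfolding split using int integral_cl_partial_orthogonal[OF assms, of None, folded X_def] by simp
  moreover have "(LINT x|lborel. X x \<bullet> P x)
      \<le> (LINT x|lborel. (norm (X x))\<^sup>2 / 2 + (norm (P x))\<^sup>2 / 2)"
    using int by (intro integral_mono) (auto intro: order_trans[OF abs_ge_self abs_inner_le_sq])
  ultimately show ?thesis using int by (simp flip: X_def P_def)
qed

text \<open>Integration by parts against the coordinate function, whose derivative is 1, bounds the
  square of \<open>a\<close> by the product of \<open>a\<close>, \<open>a'\<close> and the
  coordinate. On the support the coordinate is at most \<open>R\<close>.\<close>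

lemma poincare_component:
  fixes a a' :: "real ^ 'i::finite \<Rightarrow> real"
  assumes a: "compactly_supported a" and da: "directional_deriv (axis i 1) a a'"
    and ca: "continuous_on UNIV a'" and R: "\<And>x. a x \<noteq> 0 \<Longrightarrow> \<bar>x $ i\<bar> \<le> R"
  shows "(LINT x|lborel. (a x)\<^sup>2) \<le> 4 * R\<^sup>2 * (LINT x|lborel. (a' x)\<^sup>2)"
proof -
  have a': "compactly_supported a'"
    by (rule compactly_supported_directional_deriv[OF a da ca])
  have int: "integrable lborel (\<lambda>x. (a x)\<^sup>2)" "integrable lborel (\<lambda>x. (a' x)\<^sup>2)"
      "integrable lborel (\<lambda>x. (a' x * a x + a x * a' x) * x $ i)"
    using a a' ca compactly_supported_continuous[OF a]
    by (auto simp: power2_eq_square distrib_right mult.assoc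
        intro!: compactly_supported_integrable compactly_supported_mult_left continuous_intros)
  have "directional_deriv (axis i 1) (\<lambda>x. x $ i) (\<lambda>_. 1)"
    unfolding directional_deriv_def by (auto simp: axis_def intro!: derivative_eq_intros)
  then have "(LINT x|lborel. (a' x * a x + a x * a' x) * x $ i) = - (LINT x|lborel. a x * a x * 1)"
    using ca compactly_supported_continuous[OF a]
    by (intro integral_by_parts_directional[OF _ directional_deriv_mult[OF da da]]
        compactly_supported_mult_left[OF a]) (auto intro!: continuous_intros)
  then have "(LINT x|lborel. (a x)\<^sup>2) = (LINT x|lborel. - ((a' x * a x + a x * a' x) * x $ i))"
    by (simp add: power2_eq_square)
  also have "\<dots> \<le> (LINT x|lborel. (a x)\<^sup>2 / 2 + 2 * R\<^sup>2 * (a' x)\<^sup>2)"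
  proof (rule integral_mono)
    fix x
    show "- ((a' x * a x + a x * a' x) * x $ i) \<le> (a x)\<^sup>2 / 2 + 2 * R\<^sup>2 * (a' x)\<^sup>2"
    proof (cases "a x = 0")
      case False
      \<comment> \<open>This square leaves half of \<open>(a x)\<^sup>2\<close> on the right, to be
        absorbed; doubling then produces the constant \<open>4 * R\<^sup>2\<close>.\<close>
      have "0 \<le> (a x + 2 * (x $ i) * a' x)\<^sup>2" by simp
      then have "- ((a' x * a x + a x * a' x) * x $ i) \<le> (a x)\<^sup>2 / 2 + 2 * (x $ i)\<^sup>2 * (a' x)\<^sup>2"
        by (simp add: power2_eq_square algebra_simps)
      moreover have "(x $ i)\<^sup>2 \<le> R\<^sup>2"
        using R[OF False] by (rule abs_le_square_iff[THEN iffD1, OF order_trans]) simp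
      then have "(x $ i)\<^sup>2 * (a' x)\<^sup>2 \<le> R\<^sup>2 * (a' x)\<^sup>2" by (rule mult_right_mono) simp
      ultimately show ?thesis by simp
    qed simp
  qed (use int in auto)
  finally show ?thesis using int by simp
qed

lemma norm_sq_vec: "(norm (y :: real ^ 'k::finite))\<^sup>2 = (\<Sum>A\<in>UNIV. (y $ A)\<^sup>2)"
  unfolding power2_norm_eq_inner inner_vec_def by (simp add: power2_eq_square)

text \<open>The Poincare inequality for each component in direction \<open>None\<close>, followed by
  the bound on that derivative.\<close>

lemma integral_test_function_le_Dbar_right:
  assumes \<alpha>: "\<alpha> \<in> test_functions \<Omega>" and R: "\<And>x. x \<in> \<Omega> \<Longrightarrow> norm x \<le> R"
  shows "(LINT x|lborel. (norm (\<alpha> x))\<^sup>2) \<le> 4 * R\<^sup>2 * (LINT x|lborel. (norm (Dbar_right \<alpha> x))\<^sup>2)"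
proof -
  note c = compactly_supported_component[OF test_functions_compactly_supported[OF \<alpha>]]
    and c' = compactly_supported_component[OF cl_partial_compactly_supported[OF \<alpha>]]
    and d = cl_partial_directional_deriv[OF \<alpha>] and cd = cl_partial_continuous[OF \<alpha>]
  have int: "integrable lborel (\<lambda>x. (\<alpha> x $ A)\<^sup>2)" "integrable lborel (\<lambda>x. (cl_partial i \<alpha> x $ A)\<^sup>2)" for i A
    unfolding power2_eq_square
    by (intro compactly_supported_integrable compactly_supported_mult_left
        compactly_supported_continuous c c')+
  have R': "\<bar>x $ None\<bar> \<le> R" if "\<alpha> x $ A \<noteq> 0" for x A
  proof -
    have "x \<in> \<Omega>" using that test_functions_zero_outside[OF \<alpha>, of x] by fastforce
    then show ?thesis using R component_le_norm_cart[of x None] order_trans by blast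
  qed
  have "(LINT x|lborel. (norm (\<alpha> x))\<^sup>2) = (\<Sum>A\<in>UNIV. LINT x|lborel. (\<alpha> x $ A)\<^sup>2)"
    unfolding norm_sq_vec using int by (intro Bochner_Integration.integral_sum) auto
  also have "\<dots> \<le> (\<Sum>A\<in>UNIV. 4 * R\<^sup>2 * (LINT x|lborel. (cl_partial None \<alpha> x $ A)\<^sup>2))"
    by (intro sum_mono poincare_component[OF c d cd R'])
  also have "\<dots> = 4 * R\<^sup>2 * (LINT x|lborel. (norm (cl_partial None \<alpha> x))\<^sup>2)"
    unfolding norm_sq_vec using int
    by (subst Bochner_Integration.integral_sum) (auto simp: sum_distrib_left)
  also have "\<dots> \<le> 4 * R\<^sup>2 * (LINT x|lborel. (norm (Dbar_right \<alpha> x))\<^sup>2)"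
    by (intro mult_left_mono integral_cl_partial_le_Dbar_right[OF \<alpha>]) auto
  finally show ?thesis .
qed

lemma Dbar_right_zero_outside:
  assumes "\<alpha> \<in> test_functions \<Omega>" "x \<notin> \<Omega>"
  shows "Dbar_right \<alpha> x = 0"
proof -
  obtain K where K: "compact K" "K \<subseteq> \<Omega>" "\<And>x. x \<notin> K \<Longrightarrow> \<alpha> x = 0"
    using test_functions_support[OF assms(1)] by blast
  have "cl_partial i \<alpha> x $ A = 0" for i A
    using K assms(2) by (intro directional_deriv_zero_outside[OF
        cl_partial_directional_deriv[OF assms(1)] compact_imp_closed[OF K(1)]]) auto
  then have "cl_partial i \<alpha> x = 0" for i
    by (simp add: vec_eq_iff)
  then show ?thesis by (simp add: Dbar_right_eq cl_mult.zero_left)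
qed

section \<open>Existence of weak solutions\<close>

text \<open>The bridge between integrals over the domain, as in the definitions, and integrals over
  the whole space, where translation is available. Lebesgue measure is the completion of
  \<open>lborel\<close>, and \<open>g\<close> is Borel.\<close>

lemma integral_lebesgue_on_eq_lborel:
  fixes g :: "'a::euclidean_space \<Rightarrow> 'b::{banach, second_countable_topology}"
  assumes "open \<Omega>" "g \<in> borel_measurable borel" "\<And>x. x \<notin> \<Omega> \<Longrightarrow> g x = 0"
  shows "(LINT x|lebesgue_on \<Omega>. g x) = (LINT x|lborel. g x)"
    and "integrable (lebesgue_on \<Omega>) g \<longleftrightarrow> integrable lborel g"
proof -
  have g: "(\<lambda>x. indicator \<Omega> x *\<^sub>R g x) = g"
    using assms(3) by (auto simp: fun_eq_iff indicator_def)
  show "(LINT x|lebesgue_on \<Omega>. g x) = (LINT x|lborel. g x)"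
    using assms g by (subst integral_restrict_space) (auto simp: integral_completion)
  show "integrable (lebesgue_on \<Omega>) g \<longleftrightarrow> integrable lborel g"
    using assms g by (subst integrable_restrict_space) (auto simp: integrable_completion)
qed

lemma compactly_supported_norm_sq_lebesgue_on:
  fixes g :: "'a::euclidean_space \<Rightarrow> 'b::euclidean_space"
  assumes "open \<Omega>" "compactly_supported g" "\<And>x. x \<notin> \<Omega> \<Longrightarrow> g x = 0"
  shows "square_integrable (lebesgue_on \<Omega>) g"
    and "(LINT x|lebesgue_on \<Omega>. (norm (g x))\<^sup>2) = (LINT x|lborel. (norm (g x))\<^sup>2)"
proof -
  have g[measurable]: "g \<in> borel_measurable borel"
    using assms(2) by (intro borel_measurable_continuous_onI compactly_supported_continuous)
  have "integrable lborel (\<lambda>x. (norm (g x))\<^sup>2)"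
    unfolding power2_norm_eq_inner
    by (intro compactly_supported_integrable compactly_supported_inner assms)
  then have "integrable (lebesgue_on \<Omega>) (\<lambda>x. (norm (g x))\<^sup>2)"
    using assms by (subst integral_lebesgue_on_eq_lborel) auto
  moreover have "g \<in> borel_measurable (lebesgue_on \<Omega>)"
    by (intro measurable_restrict_space1 measurable_completion) simp
  ultimately show "square_integrable (lebesgue_on \<Omega>) g"
    by (simp add: square_integrable_def)
  show "(LINT x|lebesgue_on \<Omega>. (norm (g x))\<^sup>2) = (LINT x|lborel. (norm (g x))\<^sup>2)"
    using assms by (intro integral_lebesgue_on_eq_lborel) auto
qed

text \<open>The squared norm is the finite sum of the squared components and dominates each of
  them.\<close>

lemma L2_iff_square_integrable: "f \<in> L2 \<Omega> \<longleftrightarrow> square_integrable (lebesgue_on \<Omega>) f"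
proof
  assume f: "f \<in> L2 \<Omega>"
  have "f \<in> borel_measurable (lebesgue_on \<Omega>)"
    using f by (subst borel_measurable_euclidean_space) (auto simp: L2_def Basis_vec_def inner_axis)
  then show "square_integrable (lebesgue_on \<Omega>) f"
    using f by (auto simp: square_integrable_def L2_def norm_sq_vec)
next
  assume f: "square_integrable (lebesgue_on \<Omega>) f"
  have m[measurable]: "(\<lambda>x. f x $ A) \<in> borel_measurable (lebesgue_on \<Omega>)" for A
  proof -
    have "f \<in> borel_measurable (lebesgue_on \<Omega>)"
      using f by (simp add: square_integrable_def)
    moreover have "(\<lambda>v. v $ A) \<in> borel_measurable borel"
      by (intro borel_measurable_continuous_onI continuous_intros)
    ultimately show ?thesis by (rule measurable_compose)
  qed
  have "integrable (lebesgue_on \<Omega>) (\<lambda>x. (f x $ A)\<^sup>2)" for A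
  proof (rule Bochner_Integration.integrable_bound)
    show "integrable (lebesgue_on \<Omega>) (\<lambda>x. (norm (f x))\<^sup>2)"
      using f by (simp add: square_integrable_def)
    have "\<bar>f x $ A\<bar> \<le> norm (f x)" for x by (rule component_le_norm_cart)
    then show "AE x in lebesgue_on \<Omega>. norm ((f x $ A)\<^sup>2) \<le> norm ((norm (f x))\<^sup>2)"
      by (simp add: abs_le_square_iff[symmetric])
  qed measurable
  then show "f \<in> L2 \<Omega>" by (simp add: L2_def m)
qed

lemma square_integrable_twist:
  fixes f :: "'a \<Rightarrow> 'n::{finite,linorder} clifford"
  assumes "square_integrable M f"
  shows "square_integrable M (\<lambda>x. cl_twist (f x))"
proof -
  have "bounded_linear (cl_twist :: 'n clifford \<Rightarrow> _)"
    using linear_cl_twist by (rule linear_conv_bounded_linear[THEN iffD1])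
  then have "continuous_on UNIV (cl_twist :: 'n clifford \<Rightarrow> _)"
    by (rule linear_continuous_on)
  then show ?thesis
    using assms measurable_compose[OF _ borel_measurable_continuous_onI, of f M cl_twist]
    by (simp add: square_integrable_def norm_cl_twist)
qed

text \<open>The product is bounded bilinear, so its norm is dominated by a multiple of the sum of
  the squared norms. Integrability justifies taking components inside the integral.\<close>

lemma integrable_cl_mult:
  fixes f g :: "'a \<Rightarrow> 'n::{finite,linorder} clifford"
  assumes f: "square_integrable M f" and g: "square_integrable M g"
  shows "integrable M (\<lambda>x. f x \<odot> g x)"
proof -
  have [measurable]: "f \<in> borel_measurable M" "g \<in> borel_measurable M"
    using assms by (auto simp: square_integrable_def)
  obtain c where c: "c \<ge> 0" "\<And>x y. norm (x \<odot> y :: 'n clifford) \<le> norm x * norm y * c"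
    using cl_mult.nonneg_bounded by blast
  have "continuous_on UNIV (\<lambda>p. fst p \<odot> snd p :: 'n clifford)"
    by (intro cl_mult.continuous_on continuous_intros)
  then have "(\<lambda>p. fst p \<odot> snd p :: 'n clifford) \<in> borel_measurable borel"
    by (rule borel_measurable_continuous_onI)
  then have m: "(\<lambda>x. f x \<odot> g x) \<in> borel_measurable M"
    using measurable_compose[of "\<lambda>x. (f x, g x)" M borel "\<lambda>p. fst p \<odot> snd p" borel] by simp
  have "integrable M (\<lambda>x. ((norm (f x))\<^sup>2 + (norm (g x))\<^sup>2) * c)"
    using assms by (auto simp: square_integrable_def)
  then show ?thesis
  proof (rule Bochner_Integration.integrable_bound[OF _ m])
    show "AE x in M. norm (f x \<odot> g x) \<le> norm (((norm (f x))\<^sup>2 + (norm (g x))\<^sup>2) * c)"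
    proof (rule AE_I2)
      fix x
      have "norm (f x) * norm (g x) \<le> (norm (f x))\<^sup>2 + (norm (g x))\<^sup>2"
        using sum_squares_bound[of "norm (f x)" "norm (g x)"]
          mult_nonneg_nonneg[OF norm_ge_zero[of "f x"] norm_ge_zero[of "g x"]] by linarith
      then have "norm (f x) * norm (g x) * c \<le> ((norm (f x))\<^sup>2 + (norm (g x))\<^sup>2) * c"
        using c(1) by (rule mult_right_mono)
      then show "norm (f x \<odot> g x) \<le> norm (((norm (f x))\<^sup>2 + (norm (g x))\<^sup>2) * c)"
        using c by (auto intro: order_trans)
    qed
  qed
qed

lemma integral_component:
  fixes f :: "'a \<Rightarrow> real ^ 'k::finite"
  assumes "integrable M f"
  shows "(LINT x|M. f x) $ A = (LINT x|M. f x $ A)"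
  by (rule integral_bounded_linear[OF bounded_linear_vec_nth assms, symmetric])

theorem mainTheorem6:
  fixes \<Omega> :: "(real ^ ('n::{finite,linorder} option)) set"
  assumes "open \<Omega>" and "connected \<Omega>" and "\<Omega> \<noteq> {}" and "bounded \<Omega>"
  shows "\<forall>f \<in> L2 \<Omega>. \<exists>u \<in> L2 \<Omega>. weak_Dbar_solution \<Omega> u f"
proof
  fix f assume "f \<in> L2 \<Omega>"
  define M where "M = lebesgue_on \<Omega>"
  have f: "square_integrable M f"
    using \<open>f \<in> L2 \<Omega>\<close> by (simp add: M_def L2_iff_square_integrable)
  \<comment> \<open>With the conjugate of \<open>f\<close>, the scalar part of
    \<open>\<alpha> x \<odot> f x\<close> becomes the inner product of \<open>\<alpha> x\<close>
    with \<open>g x\<close>.\<close>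
  define g where "g x = cl_twist (f x)" for x
  have g: "square_integrable M g"
    unfolding g_def[abs_def] by (rule square_integrable_twist[OF f])
  have M: "finite_measure M"
    unfolding M_def by (intro finite_measure_lebesgue_on lmeasurable_open assms)
  obtain R where R: "\<And>x. x \<in> \<Omega> \<Longrightarrow> norm x \<le> R"
    using assms(4) by (auto simp: bounded_iff)
  have sq: "square_integrable M \<alpha>" "square_integrable M (Dbar_right \<alpha>)"
    and le: "(LINT x|M. (norm (\<alpha> x))\<^sup>2) \<le> 4 * R\<^sup>2 * (LINT x|M. (norm (Dbar_right \<alpha> x))\<^sup>2)"
    if \<alpha>: "\<alpha> \<in> test_functions \<Omega>" for \<alpha>
    using compactly_supported_norm_sq_lebesgue_on[OF assms(1)
        test_functions_compactly_supported[OF \<alpha>] test_functions_zero_outside[OF \<alpha>]]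
      compactly_supported_norm_sq_lebesgue_on[OF assms(1)
        Dbar_right_compactly_supported[OF \<alpha>] Dbar_right_zero_outside[OF \<alpha>]]
      integral_test_function_le_Dbar_right[OF \<alpha> R]
    by (simp_all add: M_def)
  define l where "l \<alpha> = - (LINT x|M. \<alpha> x \<bullet> g x)" for \<alpha>
  \<comment> \<open>The constant of the a priori estimate, enlarged by 1 so that it is positive even
    for \<open>R = 0\<close> and can be cancelled.\<close>
  define K where "K = 4 * R\<^sup>2 + 1"
  have K: "K > 0" unfolding K_def by (rule add_nonneg_pos) auto
  obtain w where w: "square_integrable M w"
    and wl: "\<And>\<alpha>. \<alpha> \<in> test_functions \<Omega> \<Longrightarrow> (LINT x|M. w x \<bullet> Dbar_right \<alpha> x) = l \<alpha>"
  proof (rule L2_representation[OF M, of "test_functions \<Omega>" Dbar_right l "K * (LINT x|M. (norm (g x))\<^sup>2) / 2"])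
    \<comment> \<open>The zero function, with empty support.\<close>
    show "test_functions \<Omega> \<noteq> {}"
      using test_functionsI[of "\<lambda>_. 0" "{}" \<Omega>] by (auto simp: smooth_def C_k_zero)
    show "l (\<lambda>x. a x + t *\<^sub>R b x) = l a + t * l b"
      if "a \<in> test_functions \<Omega>" "b \<in> test_functions \<Omega>" for a b t
      using integrable_inner[OF sq(1)[OF that(1)] g] integrable_inner[OF sq(1)[OF that(2)] g]
      by (simp add: l_def inner_add_left algebra_simps)
    show "l a \<le> K * (LINT x|M. (norm (g x))\<^sup>2) / 2 + (LINT x|M. (norm (Dbar_right a x))\<^sup>2) / 2"
      if a: "a \<in> test_functions \<Omega>" for a
    proof -
      define N D G where "N = (LINT x|M. (norm (a x))\<^sup>2)"
        and "D = (LINT x|M. (norm (Dbar_right a x))\<^sup>2)" and "G = (LINT x|M. (norm (g x))\<^sup>2)"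
      \<comment> \<open>Young's inequality with weight \<open>K\<close>: dividing by
        \<open>K\<close> later turns \<open>N \<le> K * D\<close> into the exact coefficient of
        \<open>D\<close> demanded by \<open>L2_representation\<close>.\<close>
      have "0 \<le> (LINT x|M. (norm (a x + K *\<^sub>R g x))\<^sup>2)" by simp
      also have "\<dots> = N - 2 * K * l a + K\<^sup>2 * G"
        unfolding integral_norm_sq_affine[OF sq(1)[OF a] g] by (simp add: N_def G_def l_def)
      finally have "2 * K * l a \<le> N + K\<^sup>2 * G" by simp
      also have "N \<le> K * D"
        using le[OF a] by (simp add: N_def D_def K_def distrib_right add_increasing2)
      finally have "K * (2 * l a) \<le> K * (D + K * G)"
        by (simp add: power2_eq_square algebra_simps)
      then have "2 * l a \<le> D + K * G" using K by simp
      then show ?thesis by (simp add: D_def G_def)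
    qed
  qed (use test_functions_affine Dbar_right_affine sq in auto)
  \<comment> \<open>Conjugation is an involution, so the inner product with \<open>w\<close> is the
    scalar part of the Clifford product with \<open>u\<close>.\<close>
  define u where "u x = cl_twist (w x)" for x
  have u: "square_integrable M u"
    unfolding u_def[abs_def] by (rule square_integrable_twist[OF w])
  have "weak_Dbar_solution \<Omega> u f"
    unfolding weak_Dbar_solution_def M_def[symmetric]
  proof
    fix \<alpha> assume \<alpha>: "\<alpha> \<in> test_functions \<Omega>"
    note T = test_functions_mult[OF \<alpha>]
    \<comment> \<open>Component \<open>C\<close> is the scalar identity for the test function
      \<open>\<lambda>x. cl_basis C \<odot> \<alpha> x\<close>, with the same sign on both
      sides.\<close>
    have "(LINT x|M. \<alpha> x \<odot> f x) $ C = (- (LINT x|M. Dbar_right \<alpha> x \<odot> u x)) $ C" for C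
    proof -
      have "(LINT x|M. \<alpha> x \<odot> f x) $ C = (LINT x|M. (\<alpha> x \<odot> f x) $ C)"
        by (rule integral_component[OF integrable_cl_mult[OF sq(1)[OF \<alpha>] f]])
      also have "\<dots> = - (cl_sign C C * l (\<lambda>x. cl_basis C \<odot> \<alpha> x))"
        by (simp add: cl_mult_component_twist l_def g_def)
      also have "l (\<lambda>x. cl_basis C \<odot> \<alpha> x) = (LINT x|M. w x \<bullet> Dbar_right (\<lambda>x. cl_basis C \<odot> \<alpha> x) x)"
        by (rule wl[OF T, symmetric])
      also have "cl_sign C C * \<dots> = (LINT x|M. (Dbar_right \<alpha> x \<odot> u x) $ C)"
        unfolding Dbar_right_mult[OF \<alpha>]
        by (simp add: cl_mult_component_twist u_def cl_twist_twist inner_commute)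
      also have "\<dots> = (LINT x|M. Dbar_right \<alpha> x \<odot> u x) $ C"
        by (rule integral_component[OF integrable_cl_mult[OF sq(2)[OF \<alpha>] u], symmetric])
      finally show ?thesis by simp
    qed
    then show "(LINT x|M. \<alpha> x \<odot> f x) = - (LINT x|M. Dbar_right \<alpha> x \<odot> u x)"
      by (simp add: vec_eq_iff)
  qed
  with u show "\<exists>u\<in>L2 \<Omega>. weak_Dbar_solution \<Omega> u f"
    by (auto simp: M_def L2_iff_square_integrable)
qed

end
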